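(* Let $\alpha,\beta\in\mathbb{R}$ with $\alpha\neq\pm\beta$, and let $M$ be a helicoidal flat surface in $\mathbb{S}^3$, locally parametrized by the immersion $$X(t,s)=\phi_{\alpha,\beta}(t)\cdot\gamma(s),$$ whose profile curve $\gamma$, parametrized by arc length, is $$\gamma(s)=\big(\cos\varphi(s)\cos\theta(s),\ \cos\varphi(s)\sin\theta(s),\ \sin\varphi(s),\ 0\big),\qquad \sin\varphi(s)>0,$$ with $\varphi,\theta$ smooth. Then $M$ admits, locally (in a neighbourhood of each point), a new parametrization with coordinates $(u,v)$ in which its first and second fundamental forms (for a suitable unit normal field) are $$I=du^2+2\cos\omega\,du\,dv+dv^2,\qquad II=2\sin\omega\,du\,dv,$$ where $\omega$ is a linear function, i.e. $\omega(u,v)=\lambda_1u+\lambda_2v+\lambda_3$ for some constants $\lambda_1,\lambda_2,\lambda_3\in\mathbb{R}$.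
   Context: $\mathbb{S}^3\subset\mathbb{R}^4$ is the unit sphere with its standard metric. A surface is flat if the Gauss curvature of its induced metric vanishes identically. For $\alpha,\beta\in\mathbb{R}$, $$\phi_{\alpha,\beta}(t)=\begin{pmatrix}\cos\alpha t&-\sin\alpha t&0&0\\ \sin\alpha t&\cos\alpha t&0&0\\ 0&0&\cos\beta t&-\sin\beta t\\ 0&0&\sin\beta t&\cos\beta t\end{pmatrix}$$ is the helicoidal $1$-parameter group of isometries of $\mathbb{S}^3$; a surface is helicoidal if it is invariant under such a group. The profile curve lies in $\mathbb{S}^2_+=\{(x_1,x_2,x_3,0)\in\mathbb{S}^3: x_3>0\}$. *)

theory Defs
  imports "HOL-Analysis.Analysis"
begin

section \<open>Smoothness\<close>

text \<open>Two-sided derivatives are used throughout, so \<open>S\<close> is meant to be open.\<close>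

primrec times_differentiable_on ::
    "nat \<Rightarrow> 'a::real_normed_vector set \<Rightarrow> ('a \<Rightarrow> 'b::real_normed_vector) \<Rightarrow> bool" where
  "times_differentiable_on 0 S f \<longleftrightarrow> continuous_on S f"
| "times_differentiable_on (Suc k) S f \<longleftrightarrow>
     (\<forall>x\<in>S. f differentiable (at x)) \<and>
     (\<forall>v. times_differentiable_on k S (\<lambda>x. frechet_derivative f (at x) v))"

definition smooth_on ::
    "'a::real_normed_vector set \<Rightarrow> ('a \<Rightarrow> 'b::real_normed_vector) \<Rightarrow> bool" where
  "smooth_on S f \<longleftrightarrow> (\<forall>k. times_differentiable_on k S f)"

definition diffeomorphism ::
    "'a::real_normed_vector set \<Rightarrow> 'b::real_normed_vector set \<Rightarrow> ('a \<Rightarrow> 'b) \<Rightarrow> ('b \<Rightarrow> 'a) \<Rightarrow> bool" where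
  "diffeomorphism W V h k \<longleftrightarrow> homeomorphism W V h k \<and> smooth_on W h \<and> smooth_on V k"


section \<open>Intrinsic geometry of a metric in two coordinates\<close>

definition partial_derivative ::
    "2 \<Rightarrow> (real^2 \<Rightarrow> 'b::real_normed_vector) \<Rightarrow> real^2 \<Rightarrow> 'b" where
  "partial_derivative i f p = frechet_derivative f (at p) (axis i 1)"

text \<open>\<open>christoffel g k i j p\<close> is $\Gamma^k_{ij}(p)$.\<close>

definition christoffel :: "(real^2 \<Rightarrow> real^2^2) \<Rightarrow> 2 \<Rightarrow> 2 \<Rightarrow> 2 \<Rightarrow> real^2 \<Rightarrow> real" where
  "christoffel g k i j p =
     (\<Sum>l\<in>UNIV. matrix_inv (g p) $ k $ l *
        (partial_derivative i (\<lambda>q. g q $ j $ l) p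
         + partial_derivative j (\<lambda>q. g q $ i $ l) p
         - partial_derivative l (\<lambda>q. g q $ i $ j) p)) / 2"

text \<open>\<open>riemann g l i j k p\<close> is the \<open>l\<close>-th component of $R(\partial_i,\partial_j)\partial_k$, with
  $R(X,Y)Z = \nabla_X\nabla_Y Z - \nabla_Y\nabla_X Z - \nabla_{[X,Y]} Z$.\<close>

definition riemann :: "(real^2 \<Rightarrow> real^2^2) \<Rightarrow> 2 \<Rightarrow> 2 \<Rightarrow> 2 \<Rightarrow> 2 \<Rightarrow> real^2 \<Rightarrow> real" where
  "riemann g l i j k p =
     partial_derivative i (christoffel g l j k) p
     - partial_derivative j (christoffel g l i k) p
     + (\<Sum>m\<in>UNIV. christoffel g m j k p * christoffel g l i m p
                 - christoffel g m i k p * christoffel g l j m p)"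

text \<open>$K = \langle R(\partial_1,\partial_2)\partial_2, \partial_1\rangle / \det g$; with these signs
  the unit sphere has $K = 1$.\<close>

definition gauss_curvature :: "(real^2 \<Rightarrow> real^2^2) \<Rightarrow> real^2 \<Rightarrow> real" where
  "gauss_curvature g p = (\<Sum>l\<in>UNIV. riemann g l 1 2 2 p * g p $ l $ 1) / det (g p)"


section \<open>Immersed surfaces in the 3-sphere\<close>

text \<open>A surface is a map from an open subset of \<open>real^2\<close> to \<open>real^4\<close> with values in the
  unit sphere.\<close>

definition immersion_on :: "(real^2) set \<Rightarrow> (real^2 \<Rightarrow> real^4) \<Rightarrow> bool" where
  "immersion_on U X \<longleftrightarrow> smooth_on U X \<and> (\<forall>p\<in>U. inj (frechet_derivative X (at p)))"

definition first_fundamental_form ::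
    "(real^2 \<Rightarrow> real^4) \<Rightarrow> real^2 \<Rightarrow> real^2 \<Rightarrow> real^2 \<Rightarrow> real" where
  "first_fundamental_form X p \<xi> \<eta> =
     frechet_derivative X (at p) \<xi> \<bullet> frechet_derivative X (at p) \<eta>"

definition induced_metric :: "(real^2 \<Rightarrow> real^4) \<Rightarrow> real^2 \<Rightarrow> real^2^2" where
  "induced_metric X p = (\<chi> i j. first_fundamental_form X p (axis i 1) (axis j 1))"

definition flat_on :: "(real^2) set \<Rightarrow> (real^2 \<Rightarrow> real^4) \<Rightarrow> bool" where
  "flat_on U X \<longleftrightarrow> (\<forall>p\<in>U. gauss_curvature (induced_metric X) p = 0)"

text \<open>Tangency of \<open>N\<close> to the sphere is orthogonality to the position vector \<open>X\<close>.\<close>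

definition unit_normal_field ::
    "(real^2) set \<Rightarrow> (real^2 \<Rightarrow> real^4) \<Rightarrow> (real^2 \<Rightarrow> real^4) \<Rightarrow> bool" where
  "unit_normal_field U X N \<longleftrightarrow> smooth_on U N \<and>
     (\<forall>p\<in>U. norm (N p) = 1 \<and> N p \<bullet> X p = 0 \<and>
            (\<forall>\<xi>. N p \<bullet> frechet_derivative X (at p) \<xi> = 0))"

text \<open>The covariant derivative of the sphere differs from the second derivative in \<open>real^4\<close>
  by a multiple of the position vector, to which \<open>N\<close> is orthogonal.\<close>

definition second_fundamental_form ::
    "(real^2 \<Rightarrow> real^4) \<Rightarrow> (real^2 \<Rightarrow> real^4) \<Rightarrow> real^2 \<Rightarrow> real^2 \<Rightarrow> real^2 \<Rightarrow> real" where
  "second_fundamental_form X N p \<xi> \<eta> =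
     frechet_derivative (\<lambda>q. frechet_derivative X (at q) \<eta>) (at p) \<xi> \<bullet> N p"


section \<open>Helicoidal surfaces\<close>

definition helicoidal_motion :: "real \<Rightarrow> real \<Rightarrow> real \<Rightarrow> real^4^4" where
  "helicoidal_motion \<alpha> \<beta> t = vector
     [vector [cos (\<alpha> * t), - sin (\<alpha> * t), 0, 0],
      vector [sin (\<alpha> * t),   cos (\<alpha> * t), 0, 0],
      vector [0, 0, cos (\<beta> * t), - sin (\<beta> * t)],
      vector [0, 0, sin (\<beta> * t),   cos (\<beta> * t)]]"

definition profile_curve :: "(real \<Rightarrow> real) \<Rightarrow> (real \<Rightarrow> real) \<Rightarrow> real \<Rightarrow> real^4" where
  "profile_curve \<phi> \<theta> s =
     vector [cos (\<phi> s) * cos (\<theta> s), cos (\<phi> s) * sin (\<theta> s), sin (\<phi> s), 0]"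

text \<open>The coordinates are \<open>p $ 1 = t\<close> and \<open>p $ 2 = s\<close>.\<close>

definition helicoidal_surface ::
    "real \<Rightarrow> real \<Rightarrow> (real \<Rightarrow> real^4) \<Rightarrow> real^2 \<Rightarrow> real^4" where
  "helicoidal_surface \<alpha> \<beta> \<gamma> p = helicoidal_motion \<alpha> \<beta> (p $ 1) *v \<gamma> (p $ 2)"

definition helicoidal :: "real \<Rightarrow> real \<Rightarrow> (real^4) set \<Rightarrow> bool" where
  "helicoidal \<alpha> \<beta> M \<longleftrightarrow> (\<forall>t. (\<lambda>x. helicoidal_motion \<alpha> \<beta> t *v x) ` M = M)"

lemma vector_4:
  "(vector [w, x, y, z] :: 'a::zero^4) $ 1 = w"
  "(vector [w, x, y, z] :: 'a::zero^4) $ 2 = x"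
  "(vector [w, x, y, z] :: 'a::zero^4) $ 3 = y"
  "(vector [w, x, y, z] :: 'a::zero^4) $ 4 = z"
  by (simp_all add: vector_def)

lemma helicoidal_motion_add:
  "helicoidal_motion \<alpha> \<beta> t *v (helicoidal_motion \<alpha> \<beta> t' *v x) =
   helicoidal_motion \<alpha> \<beta> (t + t') *v x"
  by (simp add: helicoidal_motion_def vec_eq_iff forall_4 matrix_vector_mult_def sum_4
      vector_4 cos_add sin_add algebra_simps)

lemma helicoidal_helicoidal_surface:
  "helicoidal \<alpha> \<beta> (helicoidal_surface \<alpha> \<beta> \<gamma> ` {p. p $ 2 \<in> J})"
  unfolding helicoidal_def
proof (intro allI equalityI subsetI)
  fix t x
  assume "x \<in> (\<lambda>x. helicoidal_motion \<alpha> \<beta> t *v x) ` helicoidal_surface \<alpha> \<beta> \<gamma> ` {p. p $ 2 \<in> J}"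
  then obtain p where p: "p $ 2 \<in> J"
    and x: "x = helicoidal_motion \<alpha> \<beta> t *v helicoidal_surface \<alpha> \<beta> \<gamma> p" by blast
  have "x = helicoidal_surface \<alpha> \<beta> \<gamma> (vector [t + p $ 1, p $ 2])"
    unfolding x helicoidal_surface_def helicoidal_motion_add vector_2 ..
  moreover have "vector [t + p $ 1, p $ 2] \<in> {p :: real^2. p $ 2 \<in> J}"
    using p unfolding mem_Collect_eq vector_2 .
  ultimately show "x \<in> helicoidal_surface \<alpha> \<beta> \<gamma> ` {p. p $ 2 \<in> J}"
    by (rule image_eqI)
next
  fix t x
  assume "x \<in> helicoidal_surface \<alpha> \<beta> \<gamma> ` {p. p $ 2 \<in> J}"
  then obtain p where p: "p $ 2 \<in> J" and x: "x = helicoidal_surface \<alpha> \<beta> \<gamma> p" by blast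
  have "t + (p $ 1 - t) = p $ 1" by simp
  then have "x = helicoidal_motion \<alpha> \<beta> t *v
      helicoidal_surface \<alpha> \<beta> \<gamma> (vector [p $ 1 - t, p $ 2])"
    unfolding x helicoidal_surface_def helicoidal_motion_add vector_2 by (rule ssubst) (rule refl)
  moreover have "vector [p $ 1 - t, p $ 2] \<in> {p :: real^2. p $ 2 \<in> J}"
    using p unfolding mem_Collect_eq vector_2 .
  ultimately show
    "x \<in> (\<lambda>x. helicoidal_motion \<alpha> \<beta> t *v x) ` helicoidal_surface \<alpha> \<beta> \<gamma> ` {p. p $ 2 \<in> J}"
    by (blast intro: image_eqI)
qed

end

theory Submission
  imports Defs
begin

text \<open>
  The surface is invariant under the flow of $\partial_t$, so its fundamental forms
  $E\,dt^2 + 2F\,dt\,ds + ds^2$ and $L\,dt^2 + 2M\,dt\,ds + K\,ds^2$ depend on \<open>s\<close> alone, and all the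
  geometry reduces to one-variable calculus on \<open>J\<close>. With $W = \sqrt{E - F^2}$, flatness says that
  $\kappa = E'/(2W)$ is constant (\<open>Killing_slope_constant\<close>): the length of the Killing field grows
  linearly along its orthogonal trajectories. Everything else is algebra on top of this one
  conservation law.

  Suppose for a moment that the required coordinates exist. The curves on which $\omega$ is constant
  should be the orbits of the flow, so $u = at + f(s)$ and $v = bt + g(s)$, and comparison of the
  coefficients of $dt^2$ gives $E = a^2 + b^2 + 2ab\cos\omega$ and $L = 2ab\sin\omega$. Hence
  $L^2 + (E - a^2 - b^2)^2 = (2ab)^2$ has to hold with constants \<open>a\<close> and \<open>b\<close>. By the conservation
  law, $L^2$ is indeed a quadratic polynomial in \<open>E\<close>,
  $L^2 = (\alpha^2 + \beta^2 - \kappa^2) E - E^2 - \alpha^2\beta^2$ (\<open>L_square\<close>), which determines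
  $4a^2 = (\alpha + \beta)^2 - \kappa^2$ and $4b^2 = (\alpha - \beta)^2 - \kappa^2$
  up to exchanging them. The hypothesis
  $\alpha \neq \pm\beta$ makes both numbers positive and keeps \<open>L\<close> away from zero
  (\<open>asymptotic_constants\<close>).

  The coefficient of $dt\,ds$ in the second form and the area density then prescribe
  $f' = a(M - W)/L$ and $g' = b(M + W)/L$, up to orientation. That these functions reproduce all
  remaining coefficients follows from the Gauss equation
  $LK - M^2 = -W^2$ and the identity $EM - FL = \alpha\beta W$
  (\<open>asymptotic_form_coefficients\<close>). Since $E'$ and \<open>L\<close> are known, differentiation of
  $\cos\omega$ yields $\omega' = -2\kappa W/L = (\kappa/a) f' - (\kappa/b) g'$, and therefore
  $\omega = (\kappa/a) u - (\kappa/b) v + c$, because \<open>t\<close> cancels (\<open>angle_affine\<close>). Finally,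
  $(t, s) \mapsto (u, v)$ is a diffeomorphism onto its image (\<open>shear_diffeomorphism\<close>), and both
  fundamental forms transform as tensors (\<open>fundamental_forms_reparametrize\<close>).
\<close>

section \<open>Calculus of smooth maps\<close>

lemma times_differentiable_on_cong:
  assumes "open S" "\<And>x. x \<in> S \<Longrightarrow> f x = g x" "times_differentiable_on k S f"
  shows "times_differentiable_on k S g"
  using assms(2,3)
proof (induction k arbitrary: f g)
  case 0
  then show ?case by (simp cong: continuous_on_cong)
next
  case (Suc k)
  have D: "(g has_derivative frechet_derivative f (at x)) (at x)" if "x \<in> S" for x
    using Suc.prems that assms(1)
    by (metis frechet_derivative_works has_derivative_transform_within_open
        times_differentiable_on.simps(2))
  have "times_differentiable_on k S (\<lambda>x. frechet_derivative g (at x) v)" for v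
  proof (rule Suc.IH)
    show "times_differentiable_on k S (\<lambda>x. frechet_derivative f (at x) v)"
      using Suc.prems by simp
    show "frechet_derivative f (at x) v = frechet_derivative g (at x) v" if "x \<in> S" for x
      using frechet_derivative_at[OF D[OF that]] by simp
  qed
  then show ?case using D by (auto intro: differentiableI)
qed

lemma times_differentiable_on_SucI:
  assumes "open S" "\<And>x. x \<in> S \<Longrightarrow> (f has_derivative f' x) (at x)"
    and "\<And>v. times_differentiable_on k S (\<lambda>x. f' x v)"
  shows "times_differentiable_on (Suc k) S f"
proof -
  have "times_differentiable_on k S (\<lambda>x. frechet_derivative f (at x) v)" for v
    by (rule times_differentiable_on_cong[OF assms(1) _ assms(3)[of v]])
      (metis assms(2) frechet_derivative_at)
  then show ?thesis using assms(2) by (auto intro: differentiableI)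
qed

lemma times_differentiable_on_SucD:
  assumes "times_differentiable_on (Suc k) S f"
  shows "x \<in> S \<Longrightarrow> (f has_derivative frechet_derivative f (at x)) (at x)"
    and "times_differentiable_on k S (\<lambda>x. frechet_derivative f (at x) v)"
  using assms frechet_derivative_works by auto

lemma times_differentiable_on_Suc_imp:
  "times_differentiable_on (Suc k) S f \<Longrightarrow> times_differentiable_on k S f"
proof (induction k arbitrary: f)
  case 0
  then show ?case
    by (auto intro!: continuous_at_imp_continuous_on differentiable_imp_continuous_within)
qed simp

lemma times_differentiable_on_subset:
  assumes "times_differentiable_on k S f" "T \<subseteq> S"
  shows "times_differentiable_on k T f"
  using assms by (induction k arbitrary: f) (auto intro: continuous_on_subset)

lemma times_differentiable_on_const: "times_differentiable_on k S (\<lambda>x. c)"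
  by (induction k arbitrary: c) auto

lemma times_differentiable_on_bounded_linear:
  assumes "open S" "bounded_linear f"
  shows "times_differentiable_on k S f"
proof (cases k)
  case 0
  then show ?thesis using assms(2) by (simp add: linear_continuous_on)
next
  case (Suc m)
  then show ?thesis
    using times_differentiable_on_SucI[OF assms(1) bounded_linear_imp_has_derivative[OF assms(2)]]
      times_differentiable_on_const by blast
qed

lemma times_differentiable_on_linear_image:
  assumes "open S" "bounded_linear L" "times_differentiable_on k S f"
  shows "times_differentiable_on k S (\<lambda>x. L (f x))"
  using assms(3)
proof (induction k arbitrary: f)
  case 0
  then show ?case
    using assms(2) by (auto intro: bounded_linear.continuous_on)
next
  case (Suc k)
  show ?case
    by (rule times_differentiable_on_SucI[OF assms(1)
          bounded_linear.has_derivative[OF assms(2) times_differentiable_on_SucD(1)[OF Suc.prems]]])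
      (auto intro: Suc.IH times_differentiable_on_SucD(2)[OF Suc.prems])
qed

lemma times_differentiable_on_add:
  assumes "open S" "times_differentiable_on k S f" "times_differentiable_on k S g"
  shows "times_differentiable_on k S (\<lambda>x. f x + g x)"
  using assms(2,3)
proof (induction k arbitrary: f g)
  case 0
  then show ?case by (auto intro: continuous_intros)
next
  case (Suc k)
  show ?case
    by (rule times_differentiable_on_SucI[OF assms(1)
          has_derivative_add[OF times_differentiable_on_SucD(1)[OF Suc.prems(1)]
            times_differentiable_on_SucD(1)[OF Suc.prems(2)]]])
      (auto intro: Suc.IH times_differentiable_on_SucD(2)[OF Suc.prems(1)]
        times_differentiable_on_SucD(2)[OF Suc.prems(2)])
qed

lemma times_differentiable_on_scaleR:
  assumes "open S" "times_differentiable_on k S f" "times_differentiable_on k S g"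
  shows "times_differentiable_on k S (\<lambda>x. f x *\<^sub>R g x)"
  using assms(2,3)
proof (induction k arbitrary: f g)
  case 0
  then show ?case by (auto intro: continuous_intros)
next
  case (Suc k)
  show ?case
    by (rule times_differentiable_on_SucI[OF assms(1)
          has_derivative_scaleR[OF times_differentiable_on_SucD(1)[OF Suc.prems(1)]
            times_differentiable_on_SucD(1)[OF Suc.prems(2)]]])
      (auto intro!: times_differentiable_on_add[OF assms(1)] Suc.IH
        times_differentiable_on_Suc_imp[OF Suc.prems(1)]
        times_differentiable_on_Suc_imp[OF Suc.prems(2)]
        times_differentiable_on_SucD(2)[OF Suc.prems(1)]
        times_differentiable_on_SucD(2)[OF Suc.prems(2)])
qed

lemma times_differentiable_on_sum:
  assumes "open S" "finite I" "\<And>i. i \<in> I \<Longrightarrow> times_differentiable_on k S (f i)"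
  shows "times_differentiable_on k S (\<lambda>x. \<Sum>i\<in>I. f i x)"
  using assms(2,3)
  by (induction I rule: finite_induct)
    (auto intro: times_differentiable_on_add[OF assms(1)] times_differentiable_on_const)

text \<open>The directional derivative of a composition is $Df_{g(x)}(Dg_x v)$, in which both the
  base point and the direction vary. Expanding the direction in a basis splits this into products
  of a directional derivative of \<open>g\<close> with a fixed partial derivative of \<open>f\<close> along \<open>g\<close>, to which
  the induction hypothesis applies.\<close>

lemma times_differentiable_on_compose:
  fixes f :: "'b::euclidean_space \<Rightarrow> 'c::real_normed_vector"
  assumes "open S" "g ` S \<subseteq> T"
    and "times_differentiable_on k T f" "times_differentiable_on k S g"
  shows "times_differentiable_on k S (\<lambda>x. f (g x))"
  using assms(3,4)
proof (induction k arbitrary: f)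
  case 0
  then show ?case using assms(2) by (auto intro: continuous_on_compose2)
next
  case (Suc k)
  let ?f' = "\<lambda>y. frechet_derivative f (at y)" and ?g' = "\<lambda>x. frechet_derivative g (at x)"
  have der: "((\<lambda>x. f (g x)) has_derivative (\<lambda>v. \<Sum>b\<in>Basis. (?g' x v \<bullet> b) *\<^sub>R ?f' (g x) b)) (at x)"
    if "x \<in> S" for x
  proof -
    have f: "(f has_derivative ?f' (g x)) (at (g x))"
      using times_differentiable_on_SucD(1)[OF Suc.prems(1)] that assms(2) by blast
    have expand: "?f' (g x) w = (\<Sum>b\<in>Basis. (w \<bullet> b) *\<^sub>R ?f' (g x) b)" for w
    proof -
      have "linear (?f' (g x))" using f has_derivative_linear by blast
      then have "?f' (g x) (\<Sum>b\<in>Basis. (w \<bullet> b) *\<^sub>R b) = (\<Sum>b\<in>Basis. (w \<bullet> b) *\<^sub>R ?f' (g x) b)"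
        by (simp add: linear_sum linear_cmul)
      then show ?thesis by (simp only: euclidean_representation)
    qed
    show ?thesis
    proof (rule has_derivative_eq_rhs)
      show "((\<lambda>x. f (g x)) has_derivative (\<lambda>v. ?f' (g x) (?g' x v))) (at x)"
        by (rule has_derivative_compose[OF times_differentiable_on_SucD(1)[OF Suc.prems(2) that] f])
    qed (rule ext, rule expand)
  qed
  have "times_differentiable_on k S
      (\<lambda>x. \<Sum>b\<in>Basis. (?g' x v \<bullet> b) *\<^sub>R ?f' (g x) b)" for v
  proof (intro times_differentiable_on_sum[OF assms(1) finite_Basis]
      times_differentiable_on_scaleR[OF assms(1)])
    fix b :: 'b
    show "times_differentiable_on k S (\<lambda>x. ?g' x v \<bullet> b)"
      by (rule times_differentiable_on_linear_image[OF assms(1) bounded_linear_inner_left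
            times_differentiable_on_SucD(2)[OF Suc.prems(2)]])
    show "times_differentiable_on k S (\<lambda>x. ?f' (g x) b)"
      by (rule Suc.IH[OF times_differentiable_on_SucD(2)[OF Suc.prems(1)]
            times_differentiable_on_Suc_imp[OF Suc.prems(2)]])
  qed
  from times_differentiable_on_SucI[OF assms(1) der this] show ?case .
qed

lemma smooth_on_subset: "smooth_on S f \<Longrightarrow> T \<subseteq> S \<Longrightarrow> smooth_on T f"
  unfolding smooth_on_def using times_differentiable_on_subset by blast

lemma smooth_on_const: "smooth_on S (\<lambda>x. c)"
  unfolding smooth_on_def using times_differentiable_on_const by blast

lemma smooth_on_bounded_linear: "open S \<Longrightarrow> bounded_linear f \<Longrightarrow> smooth_on S f"
  unfolding smooth_on_def using times_differentiable_on_bounded_linear by blast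

lemma smooth_on_add:
  "open S \<Longrightarrow> smooth_on S f \<Longrightarrow> smooth_on S g \<Longrightarrow> smooth_on S (\<lambda>x. f x + g x)"
  unfolding smooth_on_def using times_differentiable_on_add by blast

lemma smooth_on_scaleR:
  "open S \<Longrightarrow> smooth_on S f \<Longrightarrow> smooth_on S g \<Longrightarrow> smooth_on S (\<lambda>x. f x *\<^sub>R g x)"
  unfolding smooth_on_def using times_differentiable_on_scaleR by blast

lemma smooth_on_mult:
  fixes f g :: "'a::real_normed_vector \<Rightarrow> real"
  shows "open S \<Longrightarrow> smooth_on S f \<Longrightarrow> smooth_on S g \<Longrightarrow> smooth_on S (\<lambda>x. f x * g x)"
  using smooth_on_scaleR[of S f g] by simp

lemma smooth_on_minus: "open S \<Longrightarrow> smooth_on S f \<Longrightarrow> smooth_on S (\<lambda>x. - f x)"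
  using smooth_on_scaleR[OF _ smooth_on_const, of S f "-1"] by simp

lemma smooth_on_diff:
  "open S \<Longrightarrow> smooth_on S f \<Longrightarrow> smooth_on S g \<Longrightarrow> smooth_on S (\<lambda>x. f x - g x)"
  using smooth_on_add[OF _ _ smooth_on_minus, of S f g] by simp

lemma smooth_on_power:
  fixes f :: "'a::real_normed_vector \<Rightarrow> real"
  shows "open S \<Longrightarrow> smooth_on S f \<Longrightarrow> smooth_on S (\<lambda>x. f x ^ n)"
  by (induction n) (auto intro: smooth_on_const smooth_on_mult)

lemma smooth_on_compose:
  fixes f :: "'b::euclidean_space \<Rightarrow> 'c::real_normed_vector"
  shows "open S \<Longrightarrow> smooth_on T f \<Longrightarrow> smooth_on S g \<Longrightarrow> g ` S \<subseteq> T \<Longrightarrow> smooth_on S (\<lambda>x. f (g x))"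
  unfolding smooth_on_def using times_differentiable_on_compose by blast

lemma smooth_on_vec:
  fixes f :: "'a::real_normed_vector \<Rightarrow> real ^ 'n"
  assumes "open S" "\<And>i. smooth_on S (\<lambda>x. f x $ i)"
  shows "smooth_on S f"
proof -
  have "times_differentiable_on k S (\<lambda>x. \<Sum>i\<in>UNIV. (f x $ i) *\<^sub>R axis i (1::real))" for k
    using assms by (intro times_differentiable_on_sum times_differentiable_on_scaleR
        times_differentiable_on_const) (auto simp: smooth_on_def)
  moreover have "(\<Sum>i\<in>UNIV. (f x $ i) *\<^sub>R axis i (1::real)) = f x" for x
    using basis_expansion[of "f x"] by (simp add: scalar_mult_eq_scaleR)
  ultimately show ?thesis unfolding smooth_on_def by simp
qed

lemma smooth_on_has_derivative:
  "smooth_on S f \<Longrightarrow> x \<in> S \<Longrightarrow> (f has_derivative frechet_derivative f (at x)) (at x)"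
  unfolding smooth_on_def using times_differentiable_on_SucD(1)[of 0] by blast

lemma smooth_on_frechet_derivative:
  "smooth_on S f \<Longrightarrow> smooth_on S (\<lambda>x. frechet_derivative f (at x) v)"
  unfolding smooth_on_def using times_differentiable_on_SucD(2) by blast

lemma smooth_on_continuous_on: "smooth_on S f \<Longrightarrow> continuous_on S f"
  unfolding smooth_on_def using times_differentiable_on.simps(1) by blast

lemma smooth_on_has_real_derivative:
  fixes f :: "real \<Rightarrow> real"
  assumes "smooth_on S f" "x \<in> S"
  shows "(f has_real_derivative frechet_derivative f (at x) 1) (at x)"
proof -
  have D: "(f has_derivative frechet_derivative f (at x)) (at x)"
    by (rule smooth_on_has_derivative[OF assms])
  have "frechet_derivative f (at x) h = frechet_derivative f (at x) 1 * h" for h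
    using linear_cmul[OF has_derivative_linear[OF D], of h 1] by (simp add: mult.commute)
  then show ?thesis
    unfolding has_field_derivative_def by (intro has_derivative_eq_rhs[OF D] ext)
qed

lemma smooth_on_cong:
  "open S \<Longrightarrow> (\<And>x. x \<in> S \<Longrightarrow> f x = g x) \<Longrightarrow> smooth_on S f \<Longrightarrow> smooth_on S g"
  unfolding smooth_on_def using times_differentiable_on_cong by blast

lemma smooth_on_deriv:
  fixes f :: "real \<Rightarrow> real"
  assumes "open S" "smooth_on S f"
  shows "x \<in> S \<Longrightarrow> (f has_real_derivative deriv f x) (at x)"
    and "smooth_on S (deriv f)"
proof -
  have deriv: "deriv f x = frechet_derivative f (at x) 1" if "x \<in> S" for x
    using smooth_on_has_real_derivative[OF assms(2) that] by (rule DERIV_imp_deriv)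
  show "(f has_real_derivative deriv f x) (at x)" if "x \<in> S"
    unfolding deriv[OF that] by (rule smooth_on_has_real_derivative[OF assms(2) that])
  show "smooth_on S (deriv f)"
    by (rule smooth_on_cong[OF assms(1) _ smooth_on_frechet_derivative[OF assms(2)]])
      (simp add: deriv)
qed

text \<open>Smoothness of maps that solve a differential equation $Dh = G(h)$ is a bootstrap: if \<open>h\<close>
  has \<open>k\<close> derivatives, then so has the right-hand side, and \<open>h\<close> has \<open>k + 1\<close>. This covers local
  inverses, whose derivative is the inverse matrix of the original derivative, taken along \<open>h\<close>.\<close>

lemma smooth_on_bootstrap:
  fixes h :: "'a::real_normed_vector \<Rightarrow> 'b::euclidean_space"
  assumes "open S" "h ` S \<subseteq> T"
    and "\<And>x. x \<in> S \<Longrightarrow> (h has_derivative (\<lambda>v. G v (h x))) (at x)"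
    and "\<And>v. smooth_on T (G v)"
  shows "smooth_on S h"
  unfolding smooth_on_def
proof
  show "times_differentiable_on k S h" for k
  proof (induction k)
    case 0
    show ?case
      using assms(3) by (auto intro!: continuous_at_imp_continuous_on has_derivative_continuous)
  next
    case (Suc k)
    have "times_differentiable_on k S (\<lambda>x. G v (h x))" for v
      using times_differentiable_on_compose[OF assms(1,2) _ Suc.IH] assms(4)
      unfolding smooth_on_def by blast
    from times_differentiable_on_SucI[OF assms(1,3) this] show ?case by simp
  qed
qed

lemma smooth_on_real_antiderivative:
  fixes f :: "real \<Rightarrow> real"
  assumes "open S" "\<And>x. x \<in> S \<Longrightarrow> (f has_real_derivative f' x) (at x)" "smooth_on S f'"
  shows "smooth_on S f"
  unfolding smooth_on_def
proof
  fix k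
  have "times_differentiable_on (Suc k) S f"
    by (rule times_differentiable_on_SucI[OF assms(1)
          assms(2)[unfolded has_field_derivative_def]])
      (use smooth_on_mult[OF assms(1,3) smooth_on_const] in \<open>auto simp: smooth_on_def\<close>)
  then show "times_differentiable_on k S f" by (rule times_differentiable_on_Suc_imp)
qed

lemma times_differentiable_on_sin_cos:
  "times_differentiable_on k (UNIV::real set) (\<lambda>x. a * sin x + b * cos x)"
proof (induction k arbitrary: a b)
  case 0
  show ?case by (auto intro!: continuous_intros)
next
  case (Suc k)
  have "((\<lambda>x. a * sin x + b * cos x) has_derivative
      (\<lambda>v. (- b * v) * sin x + (a * v) * cos x)) (at x)" for x
    by (auto intro!: derivative_eq_intros simp: algebra_simps)
  from times_differentiable_on_SucI[OF open_UNIV this Suc.IH] show ?case .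
qed

lemma smooth_on_sin: "open S \<Longrightarrow> smooth_on S f \<Longrightarrow> smooth_on S (\<lambda>x. sin (f x :: real))"
  using smooth_on_compose[of S UNIV sin f] times_differentiable_on_sin_cos[of _ 1 0]
  by (simp add: smooth_on_def)

lemma smooth_on_cos: "open S \<Longrightarrow> smooth_on S f \<Longrightarrow> smooth_on S (\<lambda>x. cos (f x :: real))"
  using smooth_on_compose[of S UNIV cos f] times_differentiable_on_sin_cos[of _ 0 1]
  by (simp add: smooth_on_def)

lemma smooth_on_inverse:
  assumes "open S" "smooth_on S f" "\<And>x. x \<in> S \<Longrightarrow> f x \<noteq> (0::real)"
  shows "smooth_on S (\<lambda>x. inverse (f x))"
proof -
  have "smooth_on (- {0}) (inverse :: real \<Rightarrow> real)"
  proof (rule smooth_on_bootstrap[where T = UNIV and G = "\<lambda>v y. - (v * y ^ 2)"])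
    show "(inverse has_derivative (\<lambda>v. - (v * inverse x ^ 2))) (at x)" if "x \<in> - {0}" for x :: real
      using that by (auto intro!: derivative_eq_intros simp: power2_eq_square)
    show "smooth_on UNIV (\<lambda>y. - (v * y\<^sup>2))" for v :: real
      by (intro smooth_on_minus smooth_on_mult smooth_on_power smooth_on_const open_UNIV
          smooth_on_bounded_linear bounded_linear_ident)
  qed auto
  from smooth_on_compose[OF assms(1) this assms(2)] show ?thesis using assms(3) by force
qed

lemma smooth_on_divide:
  fixes f g :: "'a::real_normed_vector \<Rightarrow> real"
  shows "open S \<Longrightarrow> smooth_on S f \<Longrightarrow> smooth_on S g \<Longrightarrow> (\<And>x. x \<in> S \<Longrightarrow> g x \<noteq> 0) \<Longrightarrow>
    smooth_on S (\<lambda>x. f x / g x)"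
  unfolding divide_inverse by (intro smooth_on_mult smooth_on_inverse)

lemma smooth_on_sqrt:
  assumes "open S" "smooth_on S f" "\<And>x. x \<in> S \<Longrightarrow> f x > (0::real)"
  shows "smooth_on S (\<lambda>x. sqrt (f x))"
proof -
  have "smooth_on {0<..} sqrt"
  proof (rule smooth_on_bootstrap[where T = "{0<..}" and G = "\<lambda>v y. v * inverse y / 2"])
    show "(sqrt has_derivative (\<lambda>v. v * inverse (sqrt x) / 2)) (at x)" if "x \<in> {0<..}" for x :: real
      using that by (auto intro!: derivative_eq_intros simp: field_simps)
    show "smooth_on {0<..} (\<lambda>y. v * inverse y / 2)" for v :: real
      by (intro smooth_on_divide smooth_on_mult smooth_on_inverse smooth_on_const open_greaterThan
          smooth_on_bounded_linear bounded_linear_ident) auto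
  qed auto
  from smooth_on_compose[OF assms(1) this assms(2)] show ?thesis using assms(3) by force
qed

lemmas smooth_on_intros = smooth_on_const smooth_on_add smooth_on_diff smooth_on_minus
  smooth_on_mult smooth_on_power smooth_on_divide smooth_on_sqrt smooth_on_sin smooth_on_cos

section \<open>The moving frame of a helicoidal surface\<close>

text \<open>A point of $\mathbb{R}^4 = \mathbb{R}^2 \times \mathbb{R}^2$ with coordinates \<open>a, b, c, d\<close> in the
  orthonormal frame obtained by turning the first plane by \<open>\<psi>\<close> and the second one by \<open>\<tau>\<close>. In this
  frame all vectors attached to a helicoidal surface have coordinates depending on \<open>s\<close> only.\<close>

definition frame_vector ::
    "real \<Rightarrow> real \<Rightarrow> real \<Rightarrow> real \<Rightarrow> real \<Rightarrow> real \<Rightarrow> real^4" where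
  "frame_vector a b c d \<psi> \<tau> = vector
     [a * cos \<psi> - b * sin \<psi>, a * sin \<psi> + b * cos \<psi>,
      c * cos \<tau> - d * sin \<tau>, c * sin \<tau> + d * cos \<tau>]"

lemma inner_frame_vector:
  "frame_vector a b c d \<psi> \<tau> \<bullet> frame_vector a' b' c' d' \<psi> \<tau> = a * a' + b * b' + c * c' + d * d'"
proof -
  have rot: "(a * cos x - b * sin x) * (a' * cos x - b' * sin x)
      + (a * sin x + b * cos x) * (a' * sin x + b' * cos x) = a * a' + b * b'"
    for a b a' b' x :: real
  proof -
    have "(a * cos x - b * sin x) * (a' * cos x - b' * sin x)
      + (a * sin x + b * cos x) * (a' * sin x + b' * cos x)
      = (a * a' + b * b') * ((sin x)\<^sup>2 + (cos x)\<^sup>2)" by algebra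
    then show ?thesis by simp
  qed
  show ?thesis
    using rot[of a \<psi> b a' b'] rot[of c \<tau> d c' d']
    by (simp add: frame_vector_def inner_vec_def sum_4 vector_4)
qed

lemma has_derivative_frame_vector:
  assumes "(a has_derivative a') (at x)" "(b has_derivative b') (at x)"
    and "(c has_derivative c') (at x)" "(d has_derivative d') (at x)"
    and "(\<psi> has_derivative \<psi>') (at x)" "(\<tau> has_derivative \<tau>') (at x)"
  shows "((\<lambda>x. frame_vector (a x) (b x) (c x) (d x) (\<psi> x) (\<tau> x)) has_derivative
    (\<lambda>v. frame_vector (a' v - b x * \<psi>' v) (b' v + a x * \<psi>' v)
      (c' v - d x * \<tau>' v) (d' v + c x * \<tau>' v) (\<psi> x) (\<tau> x))) (at x)"
proof -
  have "((\<lambda>x. frame_vector (a x) (b x) (c x) (d x) (\<psi> x) (\<tau> x) $ i) has_derivative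
    (\<lambda>v. frame_vector (a' v - b x * \<psi>' v) (b' v + a x * \<psi>' v)
      (c' v - d x * \<tau>' v) (d' v + c x * \<tau>' v) (\<psi> x) (\<tau> x) $ i)) (at x)" for i :: 4
    using exhaust_4[of i]
    by (elim disjE) (auto simp: frame_vector_def vector_4 algebra_simps
        intro!: derivative_eq_intros assms)
  then show ?thesis
    by (subst has_derivative_componentwise_within)
      (auto simp: Basis_vec_def inner_axis)
qed

lemma smooth_on_frame_vector:
  assumes "open U" "smooth_on U a" "smooth_on U b" "smooth_on U c" "smooth_on U d"
    and "smooth_on U \<psi>" "smooth_on U \<tau>"
  shows "smooth_on U (\<lambda>x. frame_vector (a x) (b x) (c x) (d x) (\<psi> x) (\<tau> x))"
proof (rule smooth_on_vec[OF assms(1)])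
  show "smooth_on U (\<lambda>x. frame_vector (a x) (b x) (c x) (d x) (\<psi> x) (\<tau> x) $ i)" for i :: 4
    using exhaust_4[of i]
    by (elim disjE) (auto simp: frame_vector_def vector_4
        intro!: smooth_on_add smooth_on_diff smooth_on_mult smooth_on_cos smooth_on_sin assms)
qed

lemma helicoidal_surface_frame_vector:
  "helicoidal_surface \<alpha> \<beta> (profile_curve \<phi> \<theta>) p =
    frame_vector (cos (\<phi> (p $ 2))) 0 (sin (\<phi> (p $ 2))) 0 (\<alpha> * p $ 1 + \<theta> (p $ 2)) (\<beta> * p $ 1)"
  by (simp add: helicoidal_surface_def helicoidal_motion_def profile_curve_def frame_vector_def
      vec_eq_iff forall_4 matrix_vector_mult_def sum_4 vector_4 cos_add sin_add algebra_simps)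

lemma norm_vector_derivative_profile_curve:
  assumes "(\<phi> has_real_derivative \<phi>') (at s)" "(\<theta> has_real_derivative \<theta>') (at s)"
  shows "(norm (vector_derivative (profile_curve \<phi> \<theta>) (at s)))\<^sup>2 = \<phi>'\<^sup>2 + (cos (\<phi> s))\<^sup>2 * \<theta>'\<^sup>2"
proof -
  have frame: "profile_curve \<phi> \<theta> = (\<lambda>s. frame_vector (cos (\<phi> s)) 0 (sin (\<phi> s)) 0 (\<theta> s) 0)"
    by (rule ext) (simp add: profile_curve_def frame_vector_def)
  have "((\<lambda>s. frame_vector (cos (\<phi> s)) 0 (sin (\<phi> s)) 0 (\<theta> s) 0) has_derivative
      (\<lambda>v. frame_vector (- sin (\<phi> s) * (\<phi>' * v) - 0 * (\<theta>' * v)) (0 + cos (\<phi> s) * (\<theta>' * v))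
        (cos (\<phi> s) * (\<phi>' * v) - 0 * 0) (0 + sin (\<phi> s) * 0) (\<theta> s) 0)) (at s)"
    by (rule has_derivative_frame_vector)
      (use assms in \<open>auto simp: has_field_derivative_def intro!: derivative_eq_intros\<close>)
  also have "(\<lambda>v. frame_vector (- sin (\<phi> s) * (\<phi>' * v) - 0 * (\<theta>' * v)) (0 + cos (\<phi> s) * (\<theta>' * v))
        (cos (\<phi> s) * (\<phi>' * v) - 0 * 0) (0 + sin (\<phi> s) * 0) (\<theta> s) 0)
      = (\<lambda>v. v *\<^sub>R frame_vector (- sin (\<phi> s) * \<phi>') (cos (\<phi> s) * \<theta>') (cos (\<phi> s) * \<phi>') 0 (\<theta> s) 0)"
    by (rule ext) (simp add: frame_vector_def vec_eq_iff forall_4 vector_4 algebra_simps)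
  finally have "vector_derivative (profile_curve \<phi> \<theta>) (at s)
      = frame_vector (- sin (\<phi> s) * \<phi>') (cos (\<phi> s) * \<theta>') (cos (\<phi> s) * \<phi>') 0 (\<theta> s) 0"
    unfolding frame by (intro vector_derivative_at) (simp add: has_vector_derivative_def)
  moreover have poly: "- x * p * (- x * p) + y * q * (y * q) + y * p * (y * p) + 0 * 0
      = (x\<^sup>2 + y\<^sup>2) * p\<^sup>2 + y\<^sup>2 * q\<^sup>2" for x y p q :: real
    by algebra
  ultimately have "(norm (vector_derivative (profile_curve \<phi> \<theta>) (at s)))\<^sup>2
      = ((sin (\<phi> s))\<^sup>2 + (cos (\<phi> s))\<^sup>2) * \<phi>'\<^sup>2 + (cos (\<phi> s))\<^sup>2 * \<theta>'\<^sup>2"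
    unfolding power2_norm_eq_inner by (simp only: inner_frame_vector poly)
  then show ?thesis by simp
qed

section \<open>Fundamental forms under a change of coordinates\<close>

text \<open>Differentiating $\langle D_\eta X, N\rangle = 0$ moves one derivative onto \<open>N\<close>. In this form
  the second fundamental form involves first derivatives only.\<close>

lemma second_fundamental_form_weingarten:
  assumes "open U" "smooth_on U X" "unit_normal_field U X N" "p \<in> U"
  shows "second_fundamental_form X N p \<xi> \<eta>
    = - (frechet_derivative X (at p) \<eta> \<bullet> frechet_derivative N (at p) \<xi>)"
proof -
  let ?Y = "\<lambda>q. frechet_derivative X (at q) \<eta>"
  have Y: "(?Y has_derivative frechet_derivative ?Y (at p)) (at p)"
    by (rule smooth_on_has_derivative[OF smooth_on_frechet_derivative[OF assms(2)] assms(4)])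
  have N: "(N has_derivative frechet_derivative N (at p)) (at p)"
    using assms(3,4) smooth_on_has_derivative unfolding unit_normal_field_def by blast
  have "((\<lambda>q. ?Y q \<bullet> N q) has_derivative
      (\<lambda>\<xi>. ?Y p \<bullet> frechet_derivative N (at p) \<xi> + frechet_derivative ?Y (at p) \<xi> \<bullet> N p)) (at p)"
    by (rule has_derivative_inner[OF Y N])
  moreover have "((\<lambda>q. ?Y q \<bullet> N q) has_derivative (\<lambda>\<xi>. 0)) (at p)"
  proof (rule has_derivative_transform_within_open[OF _ assms(1,4)])
    show "0 = ?Y q \<bullet> N q" if "q \<in> U" for q
      using assms(3) that by (simp add: unit_normal_field_def inner_commute)
  qed simp
  ultimately have "(\<lambda>\<xi>. ?Y p \<bullet> frechet_derivative N (at p) \<xi>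
      + frechet_derivative ?Y (at p) \<xi> \<bullet> N p) = (\<lambda>\<xi>. 0)"
    by (rule has_derivative_unique)
  from fun_cong[OF this, of \<xi>] show ?thesis
    unfolding second_fundamental_form_def by linarith
qed

text \<open>Both fundamental forms are tensors, so a change of coordinates \<open>h\<close> acts on them through
  its derivative alone. For the second form the second derivatives of \<open>h\<close> drop out because the
  Weingarten formula has no second derivatives.\<close>

lemma fundamental_forms_reparametrize:
  assumes "open U" "smooth_on U X" "unit_normal_field U X N"
    and "open W" "smooth_on W h" "h ` W \<subseteq> U"
  shows "unit_normal_field W (X \<circ> h) (N \<circ> h)"
    and "w \<in> W \<Longrightarrow> first_fundamental_form (X \<circ> h) w \<xi> \<eta>
      = first_fundamental_form X (h w) (frechet_derivative h (at w) \<xi>) (frechet_derivative h (at w) \<eta>)"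
    and "w \<in> W \<Longrightarrow> second_fundamental_form (X \<circ> h) (N \<circ> h) w \<xi> \<eta>
      = second_fundamental_form X N (h w) (frechet_derivative h (at w) \<xi>) (frechet_derivative h (at w) \<eta>)"
proof -
  have N: "smooth_on U N" using assms(3) unfolding unit_normal_field_def by blast
  have chain: "frechet_derivative (Y \<circ> h) (at w) = frechet_derivative Y (at (h w)) \<circ> frechet_derivative h (at w)"
    if "w \<in> W" "smooth_on U Y" for w and Y :: "real^2 \<Rightarrow> real^4"
  proof (rule frechet_derivative_compose)
    show "h differentiable at w"
      using smooth_on_has_derivative[OF assms(5) that(1)] by (rule differentiableI)
    have "h w \<in> U" using assms(6) that(1) by blast
    then show "Y differentiable at (h w)"
      using smooth_on_has_derivative[OF that(2)] by (blast intro: differentiableI)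
  qed
  have smooth_X: "smooth_on W (X \<circ> h)" and smooth_N: "smooth_on W (N \<circ> h)"
    unfolding comp_def using smooth_on_compose[OF assms(4) _ assms(5,6)] assms(2) N by auto
  show normal: "unit_normal_field W (X \<circ> h) (N \<circ> h)"
    using assms(3,6) smooth_N unfolding unit_normal_field_def by (auto simp: chain assms(2))
  show "first_fundamental_form (X \<circ> h) w \<xi> \<eta>
      = first_fundamental_form X (h w) (frechet_derivative h (at w) \<xi>) (frechet_derivative h (at w) \<eta>)"
    if "w \<in> W"
    using that by (simp add: first_fundamental_form_def chain assms(2))
  show "second_fundamental_form (X \<circ> h) (N \<circ> h) w \<xi> \<eta>
      = second_fundamental_form X N (h w) (frechet_derivative h (at w) \<xi>) (frechet_derivative h (at w) \<eta>)"
    if "w \<in> W"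
  proof -
    have "h w \<in> U" using assms(6) that by blast
    then show ?thesis
      using that by (simp add: second_fundamental_form_weingarten[OF assms(4) smooth_X normal]
          second_fundamental_form_weingarten[OF assms(1-3)] chain assms(2) N)
  qed
qed

section \<open>Gauss curvature of a metric invariant under translations\<close>

lemma matrix_inv_eqI:
  fixes A B :: "'a::semiring_1 ^ 'n ^ 'n"
  assumes "A ** B = mat 1" "B ** A = mat 1"
  shows "matrix_inv A = B"
  unfolding matrix_inv_def
proof (rule some_equality)
  show "A ** B = mat 1 \<and> B ** A = mat 1" using assms by simp
  show "A' = B" if "A ** A' = mat 1 \<and> A' ** A = mat 1" for A'
  proof -
    have "A' = A' ** (A ** B)" by (simp only: assms matrix_mul_rid)
    also have "\<dots> = B" using that by (simp only: matrix_mul_assoc matrix_mul_lid)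
    finally show ?thesis .
  qed
qed

lemma matrix_inv_symmetric_2:
  fixes E F G :: real
  assumes "E * G - F\<^sup>2 \<noteq> 0"
  shows "matrix_inv (vector [vector [E, F], vector [F, G]] :: real^2^2)
    = vector [vector [G / (E * G - F\<^sup>2), - F / (E * G - F\<^sup>2)],
              vector [- F / (E * G - F\<^sup>2), E / (E * G - F\<^sup>2)]]"
  by (rule matrix_inv_eqI) (use assms in \<open>auto simp: vec_eq_iff forall_2
      matrix_matrix_mult_def sum_2 mat_def vector_2 power2_eq_square divide_simps\<close>)

lemma open_strip: "open J \<Longrightarrow> open {p :: real^2. p $ 2 \<in> J}"
  using open_vimage[of J "\<lambda>p :: real^2. p $ 2"]
  by (simp add: vimage_def continuous_on_component)

lemma partial_derivative_strip:
  assumes "open J" "\<And>q. q $ 2 \<in> J \<Longrightarrow> G q = f (q $ 2)" "p $ 2 \<in> J"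
    and "(f has_real_derivative f') (at (p $ 2))"
  shows "partial_derivative 1 G p = 0" "partial_derivative 2 G p = f'"
proof -
  have "((\<lambda>q. f (q $ 2)) has_derivative (\<lambda>v. f' * v $ 2)) (at p)"
    by (rule has_derivative_compose[OF bounded_linear_imp_has_derivative[OF bounded_linear_vec_nth]
          assms(4)[unfolded has_field_derivative_def]])
  then have "(G has_derivative (\<lambda>v. f' * v $ 2)) (at p)"
    by (rule has_derivative_transform_within_open[OF _ open_strip[OF assms(1)]])
      (use assms in auto)
  then have "frechet_derivative G (at p) = (\<lambda>v. f' * v $ 2)"
    by (rule frechet_derivative_at[symmetric])
  then show "partial_derivative 1 G p = 0" "partial_derivative 2 G p = f'"
    by (simp_all add: partial_derivative_def axis_def)
qed

text \<open>For $I = E\,dt^2 + 2F\,dt\,ds + ds^2$ with coefficients depending on \<open>s\<close> only, only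
  \<open>s\<close>-derivatives survive in the Christoffel symbols and in the curvature tensor.\<close>

lemma gauss_curvature_translation_invariant:
  assumes "open J"
    and E: "\<And>s. s \<in> J \<Longrightarrow> (E has_real_derivative E' s) (at s)"
    and E': "\<And>s. s \<in> J \<Longrightarrow> (E' has_real_derivative E'' s) (at s)"
    and F: "\<And>s. s \<in> J \<Longrightarrow> (F has_real_derivative F' s) (at s)"
    and F': "\<And>s. s \<in> J \<Longrightarrow> (F' has_real_derivative F'' s) (at s)"
    and g: "\<And>q. q $ 2 \<in> J \<Longrightarrow>
      g q = vector [vector [E (q $ 2), F (q $ 2)], vector [F (q $ 2), 1]]"
    and nondegenerate: "\<And>s. s \<in> J \<Longrightarrow> E s - (F s)\<^sup>2 \<noteq> 0"
    and p: "p $ 2 = s" "s \<in> J"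
  shows "gauss_curvature g p
    = (E' s * (E' s - 2 * F s * F' s) - 2 * E'' s * (E s - (F s)\<^sup>2)) / (4 * (E s - (F s)\<^sup>2)\<^sup>2)"
proof -
  define \<Delta> where "\<Delta> s = E s - (F s)\<^sup>2" for s
  have \<Delta>: "\<Delta> s \<noteq> 0" if "s \<in> J" for s
    using nondegenerate[OF that] by (simp add: \<Delta>_def)
  have \<Delta>': "(\<Delta> has_real_derivative E' s - 2 * F s * F' s) (at s)" if "s \<in> J" for s
    unfolding \<Delta>_def[abs_def] by (auto intro!: derivative_eq_intros E F that)
  have const: "((\<lambda>s. c) has_real_derivative 0) (at s)" for c s :: real by simp
  note part = partial_derivative_strip[OF assms(1)]
  have dg: "partial_derivative 1 (\<lambda>q. g q $ i $ j) q = 0"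
    "partial_derivative 2 (\<lambda>q. g q $ 1 $ 1) q = E' (q $ 2)"
    "partial_derivative 2 (\<lambda>q. g q $ 1 $ 2) q = F' (q $ 2)"
    "partial_derivative 2 (\<lambda>q. g q $ 2 $ 1) q = F' (q $ 2)"
    "partial_derivative 2 (\<lambda>q. g q $ 2 $ 2) q = 0" if q: "q $ 2 \<in> J" for q i j
  proof -
    have 11: "g q $ 1 $ 1 = E (q $ 2)" and 12: "g q $ 1 $ 2 = F (q $ 2)"
      and 21: "g q $ 2 $ 1 = F (q $ 2)" and 22: "g q $ 2 $ 2 = 1" if "q $ 2 \<in> J" for q
      using g[OF that] by (simp_all add: vector_2)
    note d = part[OF 11 q E[OF q]] part[OF 12 q F[OF q]] part[OF 21 q F[OF q]] part[OF 22 q const]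
    show "partial_derivative 2 (\<lambda>q. g q $ 1 $ 1) q = E' (q $ 2)"
      "partial_derivative 2 (\<lambda>q. g q $ 1 $ 2) q = F' (q $ 2)"
      "partial_derivative 2 (\<lambda>q. g q $ 2 $ 1) q = F' (q $ 2)"
      "partial_derivative 2 (\<lambda>q. g q $ 2 $ 2) q = 0"
      using d by simp_all
    show "partial_derivative 1 (\<lambda>q. g q $ i $ j) q = 0"
      using exhaust_2[of i] exhaust_2[of j] d by (elim disjE) simp_all
  qed
  have inv: "matrix_inv (g q) $ 1 $ 1 = 1 / \<Delta> (q $ 2)"
    "matrix_inv (g q) $ 1 $ 2 = - F (q $ 2) / \<Delta> (q $ 2)"
    "matrix_inv (g q) $ 2 $ 1 = - F (q $ 2) / \<Delta> (q $ 2)"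
    "matrix_inv (g q) $ 2 $ 2 = E (q $ 2) / \<Delta> (q $ 2)" if "q $ 2 \<in> J" for q
    using matrix_inv_symmetric_2[of "E (q $ 2)" 1 "F (q $ 2)"] nondegenerate[OF that] g[OF that]
    by (simp_all add: vector_2 \<Delta>_def)
  note gamma = christoffel_def sum_2 dg inv
  have \<Gamma>: "christoffel g 1 1 1 q = F (q $ 2) * E' (q $ 2) / (2 * \<Delta> (q $ 2))"
    "christoffel g 2 1 1 q = - E (q $ 2) * E' (q $ 2) / (2 * \<Delta> (q $ 2))"
    "christoffel g 1 1 2 q = E' (q $ 2) / (2 * \<Delta> (q $ 2))"
    "christoffel g 1 2 1 q = E' (q $ 2) / (2 * \<Delta> (q $ 2))"
    "christoffel g 2 1 2 q = - F (q $ 2) * E' (q $ 2) / (2 * \<Delta> (q $ 2))"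
    "christoffel g 2 2 1 q = - F (q $ 2) * E' (q $ 2) / (2 * \<Delta> (q $ 2))"
    "christoffel g 1 2 2 q = F' (q $ 2) / \<Delta> (q $ 2)"
    "christoffel g 2 2 2 q = - F (q $ 2) * F' (q $ 2) / \<Delta> (q $ 2)" if "q $ 2 \<in> J" for q
    using that by (simp_all add: gamma)
  have d\<Gamma>1: "((\<lambda>s. E' s / (2 * \<Delta> s)) has_real_derivative
      (E'' s * \<Delta> s - E' s * (E' s - 2 * F s * F' s)) / (2 * (\<Delta> s)\<^sup>2)) (at s)" if "s \<in> J" for s
    by (rule derivative_eq_intros refl E'[OF that] \<Delta>'[OF that])+
      (use \<Delta>[OF that] in \<open>auto simp: power2_eq_square field_simps\<close>)
  have d\<Gamma>2: "((\<lambda>s. - F s * E' s / (2 * \<Delta> s)) has_real_derivative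
      - ((F' s * E' s + F s * E'' s) * \<Delta> s - F s * E' s * (E' s - 2 * F s * F' s))
        / (2 * (\<Delta> s)\<^sup>2)) (at s)" if "s \<in> J" for s
    by (rule derivative_eq_intros refl E'[OF that] F[OF that] \<Delta>'[OF that])+
      (use \<Delta>[OF that] in \<open>auto simp: power2_eq_square field_simps\<close>)
  have d\<Gamma>3: "((\<lambda>s. F' s / \<Delta> s) has_real_derivative
      (F'' s * \<Delta> s - F' s * (E' s - 2 * F s * F' s)) / (\<Delta> s)\<^sup>2) (at s)" if "s \<in> J" for s
    by (rule derivative_eq_intros refl F'[OF that] \<Delta>'[OF that])+
      (use \<Delta>[OF that] in \<open>auto simp: power2_eq_square field_simps\<close>)
  have d\<Gamma>4: "((\<lambda>s. - F s * F' s / \<Delta> s) has_real_derivative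
      - ((F' s * F' s + F s * F'' s) * \<Delta> s - F s * F' s * (E' s - 2 * F s * F' s)) / (\<Delta> s)\<^sup>2) (at s)"
    if "s \<in> J" for s
    by (rule derivative_eq_intros refl F'[OF that] F[OF that] \<Delta>'[OF that])+
      (use \<Delta>[OF that] in \<open>auto simp: power2_eq_square field_simps\<close>)
  have pJ: "p $ 2 \<in> J" using p by simp
  have d\<Gamma>: "partial_derivative 1 (christoffel g 1 2 2) p = 0"
    "partial_derivative 1 (christoffel g 2 2 2) p = 0"
    "partial_derivative 2 (christoffel g 1 1 2) p
      = (E'' s * \<Delta> s - E' s * (E' s - 2 * F s * F' s)) / (2 * (\<Delta> s)\<^sup>2)"
    "partial_derivative 2 (christoffel g 2 1 2) p
      = - ((F' s * E' s + F s * E'' s) * \<Delta> s - F s * E' s * (E' s - 2 * F s * F' s))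
        / (2 * (\<Delta> s)\<^sup>2)"
    using part[OF \<Gamma>(7) pJ d\<Gamma>3] part[OF \<Gamma>(8) pJ d\<Gamma>4] part[OF \<Gamma>(3) pJ d\<Gamma>1] part[OF \<Gamma>(5) pJ d\<Gamma>2] p
    by simp_all
  have gp: "g p $ 1 $ 1 = E s" "g p $ 1 $ 2 = F s" "g p $ 2 $ 1 = F s" "g p $ 2 $ 2 = 1"
    using g[OF pJ] p by (simp_all add: vector_2)
  have det: "det (g p) = \<Delta> s"
    by (simp add: det_2 gp \<Delta>_def power2_eq_square)
  have "gauss_curvature g p
      = (E' s * (E' s - 2 * F s * F' s) - 2 * E'' s * \<Delta> s) / (4 * (\<Delta> s)\<^sup>2)"
  proof -
    have E_eq: "E s = \<Delta> s + (F s)\<^sup>2" by (simp add: \<Delta>_def)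
    show ?thesis
      unfolding gauss_curvature_def riemann_def det sum_2 gp d\<Gamma> \<Gamma>[OF pJ] p(1)
      using \<Delta>[OF p(2)] unfolding E_eq
      by (simp add: field_simps power2_eq_square)
  qed
  then show ?thesis by (simp add: \<Delta>_def)
qed

section \<open>Fundamental forms of a helicoidal surface\<close>

locale unit_speed_profile =
  fixes \<alpha> \<beta> :: real and \<phi> \<theta> :: "real \<Rightarrow> real" and J :: "real set"
  assumes open_J: "open J" and smooth_\<phi>: "smooth_on J \<phi>" and smooth_\<theta>: "smooth_on J \<theta>"
    and unit_speed: "\<And>s. s \<in> J \<Longrightarrow> (deriv \<phi> s)\<^sup>2 + (cos (\<phi> s))\<^sup>2 * (deriv \<theta> s)\<^sup>2 = 1"
begin

abbreviation D where "D \<equiv> {p :: real^2. p $ 2 \<in> J}"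
abbreviation X where "X \<equiv> helicoidal_surface \<alpha> \<beta> (profile_curve \<phi> \<theta>)"
abbreviation \<psi> where "\<psi> p \<equiv> \<alpha> * p $ 1 + \<theta> (p $ 2)" for p :: "real^2"
abbreviation \<tau> where "\<tau> p \<equiv> \<beta> * p $ 1" for p :: "real^2"
abbreviation C where "C s \<equiv> cos (\<phi> s)"
abbreviation S where "S s \<equiv> sin (\<phi> s)"
abbreviation \<phi>1 where "\<phi>1 \<equiv> deriv \<phi>"
abbreviation \<phi>2 where "\<phi>2 \<equiv> deriv (deriv \<phi>)"
abbreviation \<theta>1 where "\<theta>1 \<equiv> deriv \<theta>"
abbreviation \<theta>2 where "\<theta>2 \<equiv> deriv (deriv \<theta>)"

text \<open>\<open>E\<close> and \<open>F\<close> are the coefficients of the first fundamental form (that of $ds^2$ is $1$),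
  \<open>\<Delta>\<close> is its determinant and \<open>W\<close> the area density; \<open>L\<close>, \<open>M\<close> and \<open>K\<close> are the coefficients of the
  second fundamental form for the field \<open>normal\<close>.\<close>

definition E where "E s = \<alpha>\<^sup>2 * (C s)\<^sup>2 + \<beta>\<^sup>2 * (S s)\<^sup>2"
definition F where "F s = \<alpha> * (C s)\<^sup>2 * \<theta>1 s"
definition \<Delta> where "\<Delta> s = \<beta>\<^sup>2 * (S s)\<^sup>2 + \<alpha>\<^sup>2 * (C s)\<^sup>2 * (\<phi>1 s)\<^sup>2"
definition W where "W s = sqrt (\<Delta> s)"

definition L where "L s = \<beta> * (\<alpha>\<^sup>2 - \<beta>\<^sup>2) * (S s)\<^sup>2 * (C s)\<^sup>2 * \<theta>1 s / W s"
definition M where "M s = \<alpha> * \<beta> * ((S s)\<^sup>2 + (C s)\<^sup>2 * (\<phi>1 s)\<^sup>2) / W s"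
definition K where "K s = \<beta> * (S s * C s * (\<theta>1 s * \<phi>2 s - \<phi>1 s * \<theta>2 s)
    + (S s)\<^sup>2 * (C s)\<^sup>2 * \<theta>1 s ^ 3 + 2 * (S s)\<^sup>2 * (\<phi>1 s)\<^sup>2 * \<theta>1 s) / W s"

text \<open>Up to sign, the normalized cross product of $X$, $X_t$ and $X_s$ in the moving frame.\<close>

definition normal :: "real^2 \<Rightarrow> real^4" where
  "normal p = (let s = p $ 2 in (1 / W s) *\<^sub>R frame_vector
    (- \<beta> * (S s)\<^sup>2 * C s * \<theta>1 s) (- \<beta> * S s * \<phi>1 s) (\<beta> * S s * (C s)\<^sup>2 * \<theta>1 s) (\<alpha> * C s * \<phi>1 s)
    (\<psi> p) (\<tau> p))"

lemmas smooth_\<phi>1 = smooth_on_deriv(2)[OF open_J smooth_\<phi>]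
  and smooth_\<theta>1 = smooth_on_deriv(2)[OF open_J smooth_\<theta>]

lemmas \<phi>_derivatives = smooth_on_deriv(1)[OF open_J smooth_\<phi>] smooth_on_deriv(1)[OF open_J smooth_\<phi>1]
  and \<theta>_derivatives = smooth_on_deriv(1)[OF open_J smooth_\<theta>] smooth_on_deriv(1)[OF open_J smooth_\<theta>1]

lemma open_D: "open D"
  by (rule open_strip[OF open_J])

lemma smooth_on_D: "smooth_on J f \<Longrightarrow> smooth_on D (\<lambda>p. f (p $ 2))" for f :: "real \<Rightarrow> real"
  by (rule smooth_on_compose[OF open_D _ smooth_on_bounded_linear[OF open_D bounded_linear_vec_nth]])
    auto

lemma smooth_F: "smooth_on J F" and smooth_\<Delta>: "smooth_on J \<Delta>"
  unfolding F_def[abs_def] \<Delta>_def[abs_def]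
  by (intro smooth_on_intros open_J smooth_\<phi> smooth_\<phi>1 smooth_\<theta>1)+

lemma E_F_\<Delta>:
  assumes "s \<in> J"
  shows "E s - (F s)\<^sup>2 = \<Delta> s"
proof -
  have "(F s)\<^sup>2 = \<alpha>\<^sup>2 * (C s)\<^sup>2 * ((C s)\<^sup>2 * (\<theta>1 s)\<^sup>2)"
    unfolding F_def by (simp add: power2_eq_square)
  also have "(C s)\<^sup>2 * (\<theta>1 s)\<^sup>2 = 1 - (\<phi>1 s)\<^sup>2"
    using unit_speed[OF assms] by simp
  finally show ?thesis unfolding E_def \<Delta>_def by (simp add: algebra_simps)
qed

lemma has_derivative_nth_2:
  assumes "s = p $ 2" "(f has_real_derivative f') (at s)"
  shows "((\<lambda>q :: real^2. f (q $ 2)) has_derivative (\<lambda>v. f' * v $ 2)) (at p)"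
  using has_derivative_compose[OF bounded_linear_imp_has_derivative[OF bounded_linear_vec_nth]
      assms(2)[unfolded assms(1) has_field_derivative_def]] .

lemma has_derivative_\<psi>_\<tau>:
  assumes "p \<in> D"
  shows "(\<psi> has_derivative (\<lambda>v. \<alpha> * v $ 1 + \<theta>1 (p $ 2) * v $ 2)) (at p)"
    and "(\<tau> has_derivative (\<lambda>v. \<beta> * v $ 1)) (at p)"
proof -
  have nth: "((\<lambda>q :: real^2. q $ 1) has_derivative (\<lambda>v. v $ 1)) (at p)"
    by (rule bounded_linear_imp_has_derivative[OF bounded_linear_vec_nth])
  show "(\<psi> has_derivative (\<lambda>v. \<alpha> * v $ 1 + \<theta>1 (p $ 2) * v $ 2)) (at p)"
    by (intro has_derivative_add has_derivative_mult_right nth has_derivative_nth_2[OF refl]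
        \<theta>_derivatives) (use assms in simp)
  show "(\<tau> has_derivative (\<lambda>v. \<beta> * v $ 1)) (at p)"
    by (intro has_derivative_mult_right nth)
qed

text \<open>The derivative of \<open>X\<close> in the fixed direction \<open>\<eta>\<close>, as a function of the point, so that it can be
  differentiated a second time.\<close>

definition dX :: "real^2 \<Rightarrow> real^2 \<Rightarrow> real^4" where
  "dX \<eta> p = (let s = p $ 2 in frame_vector
     (- S s * \<phi>1 s * \<eta> $ 2) (C s * (\<alpha> * \<eta> $ 1 + \<theta>1 s * \<eta> $ 2)) (C s * \<phi>1 s * \<eta> $ 2) (S s * \<beta> * \<eta> $ 1)
     (\<psi> p) (\<tau> p))"

lemma frechet_derivative_X:
  assumes "p \<in> D"
  shows "frechet_derivative X (at p) = (\<lambda>\<eta>. dX \<eta> p)"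
proof -
  define s where "s = p $ 2"
  have s: "s \<in> J" using assms by (simp add: s_def)
  have C: "((\<lambda>q. C (q $ 2)) has_derivative (\<lambda>v. - S s * \<phi>1 s * v $ 2)) (at p)"
    and S: "((\<lambda>q. S (q $ 2)) has_derivative (\<lambda>v. C s * \<phi>1 s * v $ 2)) (at p)"
    by (rule has_derivative_nth_2[OF s_def]; auto intro!: derivative_eq_intros \<phi>_derivatives s)+
  have "(X has_derivative (\<lambda>v. frame_vector
      (- S s * \<phi>1 s * v $ 2 - 0 * (\<alpha> * v $ 1 + \<theta>1 s * v $ 2))
      (0 + C s * (\<alpha> * v $ 1 + \<theta>1 s * v $ 2))
      (C s * \<phi>1 s * v $ 2 - 0 * (\<beta> * v $ 1)) (0 + S s * (\<beta> * v $ 1)) (\<psi> p) (\<tau> p))) (at p)"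
    unfolding helicoidal_surface_frame_vector[abs_def]
    using has_derivative_frame_vector[OF C has_derivative_const S has_derivative_const
        has_derivative_\<psi>_\<tau>[OF assms], of 0 0] by (simp add: s_def)
  then show ?thesis
    by (subst frechet_derivative_at[symmetric], assumption) (simp add: dX_def s_def mult.assoc Let_def)
qed

lemma smooth_X: "smooth_on D X"
  unfolding helicoidal_surface_frame_vector[abs_def]
  by (intro smooth_on_frame_vector smooth_on_intros smooth_on_D open_D open_J smooth_\<phi> smooth_\<theta>
      smooth_on_bounded_linear bounded_linear_vec_nth)

lemma first_fundamental_form_X:
  assumes "p \<in> D" "s = p $ 2"
  shows "first_fundamental_form X p \<xi> \<eta>
    = E s * \<xi> $ 1 * \<eta> $ 1 + F s * (\<xi> $ 1 * \<eta> $ 2 + \<xi> $ 2 * \<eta> $ 1) + \<xi> $ 2 * \<eta> $ 2"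
proof -
  have "s \<in> J" using assms by simp
  have "first_fundamental_form X p \<xi> \<eta> = ((S s)\<^sup>2 + (C s)\<^sup>2) * (\<phi>1 s)\<^sup>2 * (\<xi> $ 2 * \<eta> $ 2)
      + (C s)\<^sup>2 * (\<theta>1 s)\<^sup>2 * (\<xi> $ 2 * \<eta> $ 2) + E s * \<xi> $ 1 * \<eta> $ 1
      + F s * (\<xi> $ 1 * \<eta> $ 2 + \<xi> $ 2 * \<eta> $ 1)"
    unfolding first_fundamental_form_def frechet_derivative_X[OF assms(1)] dX_def Let_def
      inner_frame_vector E_def F_def assms(2) by algebra
  also have "\<dots> = ((\<phi>1 s)\<^sup>2 + (C s)\<^sup>2 * (\<theta>1 s)\<^sup>2) * (\<xi> $ 2 * \<eta> $ 2) + E s * \<xi> $ 1 * \<eta> $ 1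
      + F s * (\<xi> $ 1 * \<eta> $ 2 + \<xi> $ 2 * \<eta> $ 1)"
    by (simp add: algebra_simps)
  finally show ?thesis unfolding unit_speed[OF \<open>s \<in> J\<close>] by simp
qed

lemma induced_metric_X:
  assumes "p $ 2 \<in> J"
  shows "induced_metric X p = vector [vector [E (p $ 2), F (p $ 2)], vector [F (p $ 2), 1]]"
  using assms first_fundamental_form_X[OF _ refl, of p]
  by (simp add: induced_metric_def vec_eq_iff forall_2 vector_2 axis_def)

text \<open>\<open>\<Delta>\<close> is the squared length of the image of $\partial_t - F\,\partial_s$, which an
  immersion does not annihilate.\<close>

lemma \<Delta>_positive:
  assumes "immersion_on D X" "s \<in> J"
  shows "\<Delta> s > 0"
proof -
  define p :: "real^2" where "p = vector [0, s]"
  define \<zeta> :: "real^2" where "\<zeta> = vector [1, - F s]"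
  have p: "p \<in> D" "s = p $ 2" using assms(2) by (simp_all add: p_def vector_2)
  have "linear (frechet_derivative X (at p))"
    using smooth_on_has_derivative[OF smooth_X p(1)] by (rule has_derivative_linear)
  then have zero: "frechet_derivative X (at p) 0 = 0" by (rule linear_0)
  have "\<zeta> $ 1 = 1" by (simp add: \<zeta>_def vector_2)
  then have "\<zeta> \<noteq> 0" by auto
  moreover have "inj (frechet_derivative X (at p))"
    using assms(1) p(1) unfolding immersion_on_def by blast
  ultimately have "frechet_derivative X (at p) \<zeta> \<noteq> 0"
    using zero by (metis injD)
  then have "first_fundamental_form X p \<zeta> \<zeta> > 0"
    unfolding first_fundamental_form_def by simp
  then have "E s - (F s)\<^sup>2 > 0"
    unfolding first_fundamental_form_X[OF p] by (simp add: \<zeta>_def vector_2 power2_eq_square)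
  then show ?thesis unfolding E_F_\<Delta>[OF assms(2)] .
qed

end

locale regular_profile = unit_speed_profile +
  assumes regular: "\<And>s. s \<in> J \<Longrightarrow> \<Delta> s > 0"
begin

lemma W_positive: "s \<in> J \<Longrightarrow> W s > 0" and W_square: "s \<in> J \<Longrightarrow> (W s)\<^sup>2 = \<Delta> s"
  using regular[of s] by (auto simp: W_def)

lemma E_positive: "s \<in> J \<Longrightarrow> E s > 0"
  using E_F_\<Delta>[of s] regular[of s] zero_le_power2[of "F s"] by linarith

lemma smooth_W: "smooth_on J W"
  unfolding W_def[abs_def] by (intro smooth_on_intros open_J smooth_\<Delta> regular)

lemma W_nonzero: "s \<in> J \<Longrightarrow> W s \<noteq> 0"
  using W_positive by fastforce

lemma smooth_L: "smooth_on J L" and smooth_M: "smooth_on J M"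
  unfolding L_def[abs_def] M_def[abs_def]
  by (intro smooth_on_intros open_J smooth_W smooth_\<phi> smooth_\<phi>1 smooth_\<theta>1 W_nonzero; assumption)+

lemma unit_normal_field_normal: "unit_normal_field D X normal"
  unfolding unit_normal_field_def
proof (intro conjI ballI allI)
  have "smooth_on J (\<lambda>s. 1 / W s)"
    by (intro smooth_on_intros open_J smooth_W W_nonzero)
  then show "smooth_on D normal"
    unfolding normal_def[abs_def] Let_def
    by (intro smooth_on_scaleR smooth_on_frame_vector smooth_on_intros smooth_on_D open_D open_J
        smooth_\<phi> smooth_\<theta> smooth_\<phi>1 smooth_\<theta>1 smooth_W smooth_on_bounded_linear bounded_linear_vec_nth
        W_nonzero) auto
  fix p assume p: "p \<in> D"
  define s where "s = p $ 2"
  have s: "s \<in> J" using p by (simp add: s_def)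
  note simps = normal_def Let_def s_def[symmetric] inner_frame_vector inner_scaleR_left
    inner_scaleR_right
  have "normal p \<bullet> normal p
      = (\<beta>\<^sup>2 * (S s)\<^sup>2 * (((S s)\<^sup>2 + (C s)\<^sup>2) * ((C s)\<^sup>2 * (\<theta>1 s)\<^sup>2) + (\<phi>1 s)\<^sup>2)
        + \<alpha>\<^sup>2 * (C s)\<^sup>2 * (\<phi>1 s)\<^sup>2) / (W s)\<^sup>2"
    unfolding simps by (simp add: power2_eq_square divide_simps) algebra
  also have "\<dots> = 1"
  proof -
    have "(C s)\<^sup>2 * (\<theta>1 s)\<^sup>2 + (\<phi>1 s)\<^sup>2 = 1" using unit_speed[OF s] by simp
    then show ?thesis using W_square[OF s] regular[OF s] by (simp add: \<Delta>_def)
  qed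
  finally show "norm (normal p) = 1" by (simp add: norm_eq_sqrt_inner)
  show "normal p \<bullet> X p = 0"
    unfolding helicoidal_surface_frame_vector simps by (simp add: power2_eq_square)
  show "normal p \<bullet> frechet_derivative X (at p) \<eta> = 0" for \<eta>
  proof -
    have zero: "- \<beta> * x\<^sup>2 * y * q * (- x * p * v) + - \<beta> * x * p * (y * (\<alpha> * u + q * v))
        + \<beta> * x * y\<^sup>2 * q * (y * p * v) + \<alpha> * y * p * (x * \<beta> * u) = 0"
      if "x\<^sup>2 + y\<^sup>2 = 1" for x y p q u v :: real
      using that by algebra
    show ?thesis
      unfolding frechet_derivative_X[OF p] dX_def simps zero[OF sin_cos_squared_add] by simp
  qed
qed

lemma second_fundamental_form_normal:
  assumes "p \<in> D" "s = p $ 2"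
  shows "second_fundamental_form X normal p \<xi> \<eta>
    = L s * \<xi> $ 1 * \<eta> $ 1 + M s * (\<xi> $ 1 * \<eta> $ 2 + \<xi> $ 2 * \<eta> $ 1) + K s * \<xi> $ 2 * \<eta> $ 2"
proof -
  have s: "s \<in> J" using assms by simp
  note d = has_derivative_nth_2[OF assms(2)]
  let ?\<omega> = "\<alpha> * \<xi> $ 1 + \<theta>1 s * \<xi> $ 2" and ?\<nu> = "\<alpha> * \<eta> $ 1 + \<theta>1 s * \<eta> $ 2"
  have 1: "((\<lambda>q. - S (q $ 2) * \<phi>1 (q $ 2) * \<eta> $ 2) has_derivative
      (\<lambda>v. - (C s * (\<phi>1 s)\<^sup>2 + S s * \<phi>2 s) * \<eta> $ 2 * v $ 2)) (at p)"
    by (rule d) (auto intro!: derivative_eq_intros \<phi>_derivatives s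
        simp: algebra_simps power2_eq_square)
  have 2: "((\<lambda>q. C (q $ 2) * (\<alpha> * \<eta> $ 1 + \<theta>1 (q $ 2) * \<eta> $ 2)) has_derivative
      (\<lambda>v. (- S s * \<phi>1 s * ?\<nu> + C s * \<theta>2 s * \<eta> $ 2) * v $ 2)) (at p)"
    by (rule d) (auto intro!: derivative_eq_intros \<phi>_derivatives \<theta>_derivatives s
        simp: algebra_simps power2_eq_square)
  have 3: "((\<lambda>q. C (q $ 2) * \<phi>1 (q $ 2) * \<eta> $ 2) has_derivative
      (\<lambda>v. (- S s * (\<phi>1 s)\<^sup>2 + C s * \<phi>2 s) * \<eta> $ 2 * v $ 2)) (at p)"
    by (rule d) (auto intro!: derivative_eq_intros \<phi>_derivatives s
        simp: algebra_simps power2_eq_square)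
  have 4: "((\<lambda>q. S (q $ 2) * \<beta> * \<eta> $ 1) has_derivative
      (\<lambda>v. C s * \<phi>1 s * \<beta> * \<eta> $ 1 * v $ 2)) (at p)"
    by (rule d) (auto intro!: derivative_eq_intros \<phi>_derivatives s
        simp: algebra_simps power2_eq_square)
  have "(dX \<eta> has_derivative (\<lambda>v. frame_vector
      (- (C s * (\<phi>1 s)\<^sup>2 + S s * \<phi>2 s) * \<eta> $ 2 * v $ 2 - C s * ?\<nu> * (\<alpha> * v $ 1 + \<theta>1 s * v $ 2))
      ((- S s * \<phi>1 s * ?\<nu> + C s * \<theta>2 s * \<eta> $ 2) * v $ 2
        + - S s * \<phi>1 s * \<eta> $ 2 * (\<alpha> * v $ 1 + \<theta>1 s * v $ 2))
      ((- S s * (\<phi>1 s)\<^sup>2 + C s * \<phi>2 s) * \<eta> $ 2 * v $ 2 - S s * \<beta> * \<eta> $ 1 * (\<beta> * v $ 1))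
      (C s * \<phi>1 s * \<beta> * \<eta> $ 1 * v $ 2 + C s * \<phi>1 s * \<eta> $ 2 * (\<beta> * v $ 1))
      (\<psi> p) (\<tau> p))) (at p)"
    unfolding dX_def[abs_def] Let_def
    using has_derivative_frame_vector[OF 1 2 3 4 has_derivative_\<psi>_\<tau>[OF assms(1)]]
    unfolding assms(2)[symmetric] .
  then have "((\<lambda>q. frechet_derivative X (at q) \<eta>) has_derivative (\<lambda>v. frame_vector
      (- (C s * (\<phi>1 s)\<^sup>2 + S s * \<phi>2 s) * \<eta> $ 2 * v $ 2 - C s * ?\<nu> * (\<alpha> * v $ 1 + \<theta>1 s * v $ 2))
      ((- S s * \<phi>1 s * ?\<nu> + C s * \<theta>2 s * \<eta> $ 2) * v $ 2
        + - S s * \<phi>1 s * \<eta> $ 2 * (\<alpha> * v $ 1 + \<theta>1 s * v $ 2))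
      ((- S s * (\<phi>1 s)\<^sup>2 + C s * \<phi>2 s) * \<eta> $ 2 * v $ 2 - S s * \<beta> * \<eta> $ 1 * (\<beta> * v $ 1))
      (C s * \<phi>1 s * \<beta> * \<eta> $ 1 * v $ 2 + C s * \<phi>1 s * \<eta> $ 2 * (\<beta> * v $ 1))
      (\<psi> p) (\<tau> p))) (at p)"
    by (rule has_derivative_transform_within_open[OF _ open_D assms(1)])
      (simp add: frechet_derivative_X)
  note second = frechet_derivative_at[OF this, symmetric]
  have poly: "(- (y * p\<^sup>2 + x * p') * v' * v - y * (\<alpha> * u' + q * v') * (\<alpha> * u + q * v))
        * (- \<beta> * x\<^sup>2 * y * q)
      + ((- x * p * (\<alpha> * u' + q * v') + y * q' * v') * v + - x * p * v' * (\<alpha> * u + q * v))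
        * (- \<beta> * x * p)
      + ((- x * p\<^sup>2 + y * p') * v' * v - x * \<beta> * u' * (\<beta> * u)) * (\<beta> * x * y\<^sup>2 * q)
      + (y * p * \<beta> * u' * v + y * p * v' * (\<beta> * u)) * (\<alpha> * y * p)
      = \<beta> * (\<alpha>\<^sup>2 - \<beta>\<^sup>2) * x\<^sup>2 * y\<^sup>2 * q * u * u' + \<alpha> * \<beta> * (x\<^sup>2 + y\<^sup>2 * p\<^sup>2) * (u * v' + v * u')
        + \<beta> * (x * y * (q * p' - p * q') + x\<^sup>2 * y\<^sup>2 * q ^ 3 + 2 * x\<^sup>2 * p\<^sup>2 * q) * v * v'"
    if "x\<^sup>2 + y\<^sup>2 = 1" "p\<^sup>2 + y\<^sup>2 * q\<^sup>2 = 1" for x y p q p' q' u v u' v' :: real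
    using that by algebra
  show ?thesis
    unfolding second_fundamental_form_def second normal_def Let_def assms(2)[symmetric]
      inner_scaleR_right inner_frame_vector poly[OF sin_cos_squared_add unit_speed[OF s]]
      L_def M_def K_def by (simp add: add_divide_distrib)
qed

end

section \<open>Consequences of flatness\<close>

locale flat_profile = regular_profile +
  assumes interval_J: "is_interval J" and squares_differ: "\<alpha>\<^sup>2 \<noteq> \<beta>\<^sup>2"
    and sin_positive: "\<And>s. s \<in> J \<Longrightarrow> sin (\<phi> s) > 0"
    and flat: "flat_on D X"
begin

definition E1 where "E1 s = - 2 * (\<alpha>\<^sup>2 - \<beta>\<^sup>2) * S s * C s * \<phi>1 s"
definition E2 where "E2 s = - 2 * (\<alpha>\<^sup>2 - \<beta>\<^sup>2)
  * (((C s)\<^sup>2 - (S s)\<^sup>2) * (\<phi>1 s)\<^sup>2 + S s * C s * \<phi>2 s)"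
definition \<Delta>1 where "\<Delta>1 s = 2 * (S s * C s * \<phi>1 s * (\<beta>\<^sup>2 - \<alpha>\<^sup>2 * (\<phi>1 s)\<^sup>2) + \<alpha>\<^sup>2 * (C s)\<^sup>2 * \<phi>1 s * \<phi>2 s)"

lemma E_derivative: "s \<in> J \<Longrightarrow> (E has_real_derivative E1 s) (at s)"
  unfolding E_def[abs_def] E1_def
  by (auto intro!: derivative_eq_intros \<phi>_derivatives simp: algebra_simps power2_eq_square)

lemma E1_derivative: "s \<in> J \<Longrightarrow> (E1 has_real_derivative E2 s) (at s)"
  unfolding E1_def[abs_def] E2_def
  by (auto intro!: derivative_eq_intros \<phi>_derivatives simp: algebra_simps power2_eq_square)

lemma \<Delta>_derivative: "s \<in> J \<Longrightarrow> (\<Delta> has_real_derivative \<Delta>1 s) (at s)"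
  unfolding \<Delta>_def[abs_def] \<Delta>1_def
  by (auto intro!: derivative_eq_intros \<phi>_derivatives simp: algebra_simps power2_eq_square)

text \<open>This is the vanishing of the numerator of the Gauss curvature, in which $E' - 2FF'$ is the
  derivative of the determinant \<open>\<Delta>\<close>.\<close>

lemma flatness_equation:
  assumes "s \<in> J"
  shows "E1 s * \<Delta>1 s = 2 * E2 s * \<Delta> s"
proof -
  note F' = smooth_on_deriv[OF open_J smooth_F]
  note F'' = smooth_on_deriv(1)[OF open_J F'(2)]
  define p :: "real^2" where "p = vector [0, s]"
  have p: "p $ 2 = s" "p \<in> D" using assms by (simp_all add: p_def vector_2)
  have \<Delta>1: "\<Delta>1 s = E1 s - 2 * F s * deriv F s"
  proof -
    have "((\<lambda>s. E s - (F s)\<^sup>2) has_real_derivative E1 s - 2 * F s * deriv F s) (at s)"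
      by (auto intro!: derivative_eq_intros E_derivative F' assms)
    then have "(\<Delta> has_real_derivative E1 s - 2 * F s * deriv F s) (at s)"
      by (rule has_field_derivative_transform_within_open[OF _ open_J assms]) (rule E_F_\<Delta>)
    with \<Delta>_derivative[OF assms] show ?thesis by (rule DERIV_unique)
  qed
  have "gauss_curvature (induced_metric X) p
      = (E1 s * (E1 s - 2 * F s * deriv F s) - 2 * E2 s * (E s - (F s)\<^sup>2)) / (4 * (E s - (F s)\<^sup>2)\<^sup>2)"
  proof (rule gauss_curvature_translation_invariant[OF open_J E_derivative E1_derivative F'(1) F''
        induced_metric_X _ p(1) assms])
    show "E s - (F s)\<^sup>2 \<noteq> 0" if "s \<in> J" for s
      using E_F_\<Delta>[OF that] regular[OF that] by simp
  qed
  moreover have "gauss_curvature (induced_metric X) p = 0"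
    using flat p(2) unfolding flat_on_def by blast
  ultimately show ?thesis
    using E_F_\<Delta>[OF assms] regular[OF assms] by (simp add: \<Delta>1)
qed

text \<open>The Gauss equation: the surface has intrinsic curvature $0$ in a space of curvature $1$,
  so its extrinsic curvature is $-1$.\<close>

lemma gauss_equation:
  assumes "s \<in> J"
  shows "L s * K s = (M s)\<^sup>2 - \<Delta> s"
proof -
  define x y p q p' q' where "x = S s" and "y = C s" and "p = \<phi>1 s" and "q = \<theta>1 s"
    and "p' = \<phi>2 s" and "q' = \<theta>2 s"
  define d where "d = \<Delta> s"
  have d: "d = \<beta>\<^sup>2 * x\<^sup>2 + \<alpha>\<^sup>2 * y\<^sup>2 * p\<^sup>2" by (simp add: d_def \<Delta>_def x_def y_def p_def)
  have xy: "x\<^sup>2 + y\<^sup>2 = 1" by (simp add: x_def y_def)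
  have unit: "p\<^sup>2 + y\<^sup>2 * q\<^sup>2 = 1"
    using unit_speed[OF assms] by (simp add: y_def p_def q_def)
  have unit': "p * p' + y\<^sup>2 * (q * q') = x * y * p * q\<^sup>2"
  proof -
    have "((\<lambda>s. (\<phi>1 s)\<^sup>2 + (C s)\<^sup>2 * (\<theta>1 s)\<^sup>2) has_real_derivative
        2 * (p * p' + y\<^sup>2 * (q * q') - x * y * p * q\<^sup>2)) (at s)"
      by (auto intro!: derivative_eq_intros \<phi>_derivatives \<theta>_derivatives assms
          simp: x_def y_def p_def q_def p'_def q'_def algebra_simps power2_eq_square)
    moreover have "((\<lambda>s. (\<phi>1 s)\<^sup>2 + (C s)\<^sup>2 * (\<theta>1 s)\<^sup>2) has_real_derivative 0) (at s)"
      by (rule has_field_derivative_transform_within_open[OF DERIV_const[of 1] open_J assms])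
        (simp add: unit_speed)
    ultimately have "2 * (p * p' + y\<^sup>2 * (q * q') - x * y * p * q\<^sup>2) = 0"
      by (rule DERIV_unique)
    then show ?thesis by simp
  qed
  have ode: "x * y * p * (x * y * p * (\<beta>\<^sup>2 - \<alpha>\<^sup>2 * p\<^sup>2) + \<alpha>\<^sup>2 * y\<^sup>2 * p * p')
      = ((y\<^sup>2 - x\<^sup>2) * p\<^sup>2 + x * y * p') * d"
  proof -
    have "(- 4 * (\<alpha>\<^sup>2 - \<beta>\<^sup>2)) * (x * y * p * (x * y * p * (\<beta>\<^sup>2 - \<alpha>\<^sup>2 * p\<^sup>2) + \<alpha>\<^sup>2 * y\<^sup>2 * p * p'))
        = (- 4 * (\<alpha>\<^sup>2 - \<beta>\<^sup>2)) * (((y\<^sup>2 - x\<^sup>2) * p\<^sup>2 + x * y * p') * d)"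
      using flatness_equation[OF assms]
      unfolding E1_def \<Delta>1_def E2_def d_def x_def y_def p_def p'_def by algebra
    then show ?thesis using squares_differ by simp
  qed
  \<comment> \<open>the differentiated unit speed condition eliminates \<open>\<theta>''\<close>\<close>
  have one: "y\<^sup>2 * q * (x * y * (q * p' - p * q') + x\<^sup>2 * y\<^sup>2 * q ^ 3 + 2 * x\<^sup>2 * p\<^sup>2 * q)
      = x * y * p' + x\<^sup>2 * (y\<^sup>2 * q\<^sup>2)"
    using unit unit' by algebra
  \<comment> \<open>the flatness equation eliminates \<open>\<phi>''\<close>\<close>
  have two: "\<beta>\<^sup>2 * x\<^sup>2 * (x * y * p')
      = \<beta>\<^sup>2 * x\<^sup>2 * y\<^sup>2 * p\<^sup>2 - \<alpha>\<^sup>2 * x\<^sup>2 * y\<^sup>2 * p ^ 4 - (y\<^sup>2 - x\<^sup>2) * p\<^sup>2 * d"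
    using ode d by algebra
  have "(\<beta> * (\<alpha>\<^sup>2 - \<beta>\<^sup>2) * x\<^sup>2 * y\<^sup>2 * q)
      * (\<beta> * (x * y * (q * p' - p * q') + x\<^sup>2 * y\<^sup>2 * q ^ 3 + 2 * x\<^sup>2 * p\<^sup>2 * q))
      = (\<alpha>\<^sup>2 - \<beta>\<^sup>2) * (\<beta>\<^sup>2 * x\<^sup>2 * (x * y * p') + \<beta>\<^sup>2 * x ^ 4 * (y\<^sup>2 * q\<^sup>2))"
    using one by algebra
  also have "\<dots> = (\<alpha> * \<beta> * (x\<^sup>2 + y\<^sup>2 * p\<^sup>2))\<^sup>2 - d\<^sup>2"
  proof -
    have y: "y\<^sup>2 = 1 - x\<^sup>2" and yq: "y\<^sup>2 * q\<^sup>2 = 1 - p\<^sup>2" using xy unit by simp_all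
    show ?thesis unfolding two yq d unfolding y by algebra
  qed
  finally have "(L s * W s) * (K s * W s) = (M s * W s)\<^sup>2 - (\<Delta> s)\<^sup>2"
    using W_nonzero[OF assms]
    by (simp add: L_def M_def K_def x_def y_def p_def q_def p'_def q'_def d_def)
  then have "L s * K s * (W s)\<^sup>2 = (M s)\<^sup>2 * (W s)\<^sup>2 - (\<Delta> s)\<^sup>2"
    by (simp add: power2_eq_square mult_ac)
  then have "L s * K s * \<Delta> s = ((M s)\<^sup>2 - \<Delta> s) * \<Delta> s"
    unfolding W_square[OF assms] by (simp add: power2_eq_square algebra_simps)
  then show ?thesis using regular[OF assms] by simp
qed

text \<open>The length $\sqrt E$ of the Killing field $\partial_t$ is, on a flat surface, an affine function
  of the arc length $\sigma$ of the orthogonal trajectories. Since $d\sigma = (W/\sqrt E)\,ds$, its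
  slope is $E'/(2W)$.\<close>

lemma Killing_slope_constant:
  obtains \<kappa> where "\<And>s. s \<in> J \<Longrightarrow> E1 s = 2 * \<kappa> * W s"
proof -
  have "((\<lambda>s. E1 s / W s) has_real_derivative 0) (at s within J)" if s: "s \<in> J" for s
  proof -
    have W': "(W has_real_derivative \<Delta>1 s / (2 * W s)) (at s)"
      using DERIV_chain2[OF DERIV_real_sqrt[OF regular[OF s]] \<Delta>_derivative[OF s]]
      unfolding W_def[abs_def] by (simp add: field_simps)
    have "((\<lambda>s. E1 s / W s) has_real_derivative
        (E2 s * W s - E1 s * (\<Delta>1 s / (2 * W s))) / (W s * W s)) (at s)"
      by (rule DERIV_divide[OF E1_derivative[OF s] W' W_nonzero[OF s]])
    moreover have "E2 s * W s - E1 s * (\<Delta>1 s / (2 * W s)) = 0"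
      using flatness_equation[OF s] W_square[OF s] W_nonzero[OF s]
      by (simp add: field_simps power2_eq_square)
    ultimately show ?thesis by (simp add: has_field_derivative_at_within)
  qed
  then obtain c where c: "\<And>s. s \<in> J \<Longrightarrow> E1 s / W s = c"
    using has_field_derivative_zero_constant[of J "\<lambda>s. E1 s / W s"] interval_J
      is_interval_convex by blast
  show ?thesis
    by (rule that[of "c / 2"]) (use c W_nonzero in \<open>auto simp: field_simps\<close>)
qed

text \<open>Squaring the conservation law expresses $\varphi'^2$, and with it $\theta'^2$, through $\varphi$
  and \<open>\<Delta>\<close>; in $L^2 \Delta$ the factor \<open>\<Delta>\<close> then cancels.\<close>

lemma L_square:
  assumes "s \<in> J" "E1 s = 2 * \<kappa> * W s"
  shows "(L s)\<^sup>2 = (\<alpha>\<^sup>2 + \<beta>\<^sup>2 - \<kappa>\<^sup>2) * E s - (E s)\<^sup>2 - (\<alpha> * \<beta>)\<^sup>2"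
proof -
  define x y p q where "x = S s" and "y = C s" and "p = \<phi>1 s" and "q = \<theta>1 s"
  have xy: "x\<^sup>2 = 1 - y\<^sup>2"
    using sin_cos_squared_add[of "\<phi> s"] unfolding x_def y_def by linarith
  have unit: "y\<^sup>2 * q\<^sup>2 = 1 - p\<^sup>2"
    using unit_speed[OF assms(1)] by (simp add: y_def p_def q_def)
  have \<Delta>: "\<Delta> s = \<beta>\<^sup>2 * x\<^sup>2 + \<alpha>\<^sup>2 * y\<^sup>2 * p\<^sup>2" and E: "E s = \<alpha>\<^sup>2 * y\<^sup>2 + \<beta>\<^sup>2 * x\<^sup>2"
    by (simp_all add: \<Delta>_def E_def x_def y_def p_def)
  have slope: "(\<alpha>\<^sup>2 - \<beta>\<^sup>2)\<^sup>2 * x\<^sup>2 * y\<^sup>2 * p\<^sup>2 = \<kappa>\<^sup>2 * \<Delta> s"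
  proof -
    have "(E1 s)\<^sup>2 = 4 * \<kappa>\<^sup>2 * \<Delta> s"
      unfolding assms(2) W_square[OF assms(1), symmetric] by (simp add: power_mult_distrib)
    then show ?thesis unfolding E1_def x_def y_def p_def by algebra
  qed
  have "L s * W s = \<beta> * (\<alpha>\<^sup>2 - \<beta>\<^sup>2) * x\<^sup>2 * y\<^sup>2 * q"
    using W_nonzero[OF assms(1)] by (simp add: L_def x_def y_def q_def)
  then have "(L s)\<^sup>2 * (W s)\<^sup>2 = (\<beta> * (\<alpha>\<^sup>2 - \<beta>\<^sup>2) * x\<^sup>2 * y\<^sup>2 * q)\<^sup>2"
    by (simp only: power_mult_distrib[symmetric])
  then have "(L s)\<^sup>2 * \<Delta> s = \<beta>\<^sup>2 * (\<alpha>\<^sup>2 - \<beta>\<^sup>2)\<^sup>2 * (x\<^sup>2)\<^sup>2 * y\<^sup>2 * (y\<^sup>2 * q\<^sup>2)"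
    unfolding W_square[OF assms(1)] by algebra
  also have "\<dots> = (\<alpha>\<^sup>2 - \<beta>\<^sup>2)\<^sup>2 * x\<^sup>2 * y\<^sup>2 * \<Delta> s - ((\<alpha>\<^sup>2 - \<beta>\<^sup>2)\<^sup>2 * x\<^sup>2 * y\<^sup>2 * p\<^sup>2) * E s"
    unfolding unit unfolding \<Delta> E by algebra
  also have "\<dots> = ((\<alpha>\<^sup>2 - \<beta>\<^sup>2)\<^sup>2 * x\<^sup>2 * y\<^sup>2 - \<kappa>\<^sup>2 * E s) * \<Delta> s"
    unfolding slope by (simp add: algebra_simps)
  finally have "(L s)\<^sup>2 = (\<alpha>\<^sup>2 - \<beta>\<^sup>2)\<^sup>2 * x\<^sup>2 * y\<^sup>2 - \<kappa>\<^sup>2 * E s"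
    using regular[OF assms(1)] by simp
  also have "\<dots> = (\<alpha>\<^sup>2 + \<beta>\<^sup>2 - \<kappa>\<^sup>2) * E s - (E s)\<^sup>2 - (\<alpha> * \<beta>)\<^sup>2"
    unfolding E xy by algebra
  finally show ?thesis .
qed

text \<open>If $\kappa = 0$, then $E' = 0$ on all of \<open>J\<close>, so $\cos\varphi\,\varphi'$ vanishes identically. If
  $\cos\varphi$ were zero at \<open>s\<close>, then the derivative of this product there would be
  $-\varphi'^2 \sin\varphi$, hence $\varphi' = 0$, against unit speed. So $\varphi'$ is zero at \<open>s\<close>, and
  regularity and unit speed show that no factor of \<open>L\<close> vanishes there.\<close>

lemma slope_nonzero_at_zero_of_L:
  assumes slope: "\<And>s. s \<in> J \<Longrightarrow> E1 s = 2 * \<kappa> * W s" and s: "s \<in> J" and L: "L s = 0"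
  shows "\<kappa> \<noteq> 0"
proof
  assume \<kappa>: "\<kappa> = 0"
  have E1: "E1 r = 0" if "r \<in> J" for r using slope[OF that] \<kappa> by simp
  have stationary: "C r * \<phi>1 r = 0" if "r \<in> J" for r
    using E1[OF that] squares_differ sin_positive[OF that] by (auto simp: E1_def)
  have C: "C s \<noteq> 0"
  proof
    assume C: "C s = 0"
    have "((\<lambda>r. C r * \<phi>1 r) has_real_derivative (- S s * \<phi>1 s) * \<phi>1 s + \<phi>2 s * C s) (at s)"
      by (auto intro!: derivative_eq_intros \<phi>_derivatives s simp: algebra_simps)
    moreover have "((\<lambda>r. C r * \<phi>1 r) has_real_derivative 0) (at s)"
      by (rule has_field_derivative_transform_within_open[OF DERIV_const[of 0] open_J s])
        (simp add: stationary)
    ultimately have "(- S s * \<phi>1 s) * \<phi>1 s + \<phi>2 s * C s = 0" by (rule DERIV_unique)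
    then have "\<phi>1 s = 0" using C sin_positive[OF s] by simp
    then show False using unit_speed[OF s] C by simp
  qed
  then have "\<phi>1 s = 0" using stationary[OF s] by simp
  then have "\<beta> \<noteq> 0" "\<theta>1 s \<noteq> 0" using regular[OF s] unit_speed[OF s] by (auto simp: \<Delta>_def)
  then have "L s \<noteq> 0"
    using C sin_positive[OF s] squares_differ W_nonzero[OF s] by (simp add: L_def)
  with L show False by simp
qed

text \<open>The constants come from completing the square in $L^2 = P E - E^2 - (\alpha\beta)^2$. The
  discriminant is positive: it is a sum of squares, and if it were zero, \<open>E\<close> would be the double root
  throughout, so that $\kappa = 0$ and $\alpha^2 = \beta^2$. At a zero of \<open>L\<close> the nonnegative function $L^2$
  has a minimum, so its derivative $(P - 2E) E'$ vanishes there; the first factor is excluded by the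
  discriminant and the second one by the preceding lemma.\<close>

lemma asymptotic_constants:
  assumes "s\<^sub>0 \<in> J"
  obtains \<kappa> a b where "a > 0" "b > 0" "a\<^sup>2 - b\<^sup>2 = \<alpha> * \<beta>"
    and "\<And>s. s \<in> J \<Longrightarrow> E1 s = 2 * \<kappa> * W s" and "\<And>s. s \<in> J \<Longrightarrow> L s \<noteq> 0"
    and "\<And>s. s \<in> J \<Longrightarrow> (L s)\<^sup>2 + (E s - a\<^sup>2 - b\<^sup>2)\<^sup>2 = (2 * a * b)\<^sup>2"
proof -
  obtain \<kappa> where slope: "\<And>s. s \<in> J \<Longrightarrow> E1 s = 2 * \<kappa> * W s"
    using Killing_slope_constant by blast
  define P where "P = \<alpha>\<^sup>2 + \<beta>\<^sup>2 - \<kappa>\<^sup>2"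
  have L2: "(L s)\<^sup>2 = P * E s - (E s)\<^sup>2 - (\<alpha> * \<beta>)\<^sup>2" if "s \<in> J" for s
    using L_square[OF that slope[OF that]] by (simp add: P_def)
  have square: "(2 * E s - P)\<^sup>2 + (2 * L s)\<^sup>2 = P\<^sup>2 - (2 * (\<alpha> * \<beta>))\<^sup>2" if "s \<in> J" for s
    using L2[OF that] by algebra
  have "P * E s\<^sub>0 > 0"
    using L2[OF assms] E_positive[OF assms] zero_le_power2[of "L s\<^sub>0"] zero_le_power2[of "\<alpha> * \<beta>"]
      zero_less_power[OF E_positive[OF assms], of 2] by linarith
  then have P: "P > 0" using E_positive[OF assms] by (simp add: zero_less_mult_iff)
  have stationary: "\<kappa> = 0" if "s \<in> J" "E1 s = 0" for s
    using slope[OF that(1)] that(2) W_nonzero[OF that(1)] by simp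
  have "P\<^sup>2 - (2 * (\<alpha> * \<beta>))\<^sup>2 \<noteq> 0"
  proof
    assume disc: "P\<^sup>2 - (2 * (\<alpha> * \<beta>))\<^sup>2 = 0"
    have E: "E s = P / 2" if "s \<in> J" for s
    proof -
      have "(2 * E s - P)\<^sup>2 = 0"
        using square[OF that] disc zero_le_power2[of "2 * E s - P"] zero_le_power2[of "2 * L s"]
        by linarith
      then show ?thesis by simp
    qed
    have "(E has_real_derivative 0) (at s\<^sub>0)"
      by (rule has_field_derivative_transform_within_open[OF DERIV_const[of "P / 2"] open_J assms])
        (simp add: E)
    with E_derivative[OF assms] have "E1 s\<^sub>0 = 0" by (rule DERIV_unique)
    from stationary[OF assms this] have "P = \<alpha>\<^sup>2 + \<beta>\<^sup>2" by (simp add: P_def)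
    with disc have "(\<alpha>\<^sup>2 - \<beta>\<^sup>2)\<^sup>2 = 0" by algebra
    then show False using squares_differ by simp
  qed
  then have disc: "(2 * (\<alpha> * \<beta>))\<^sup>2 < P\<^sup>2"
    using square[OF assms] zero_le_power2[of "2 * E s\<^sub>0 - P"] zero_le_power2[of "2 * L s\<^sub>0"] by linarith
  then have "\<bar>2 * (\<alpha> * \<beta>)\<bar> < P"
    by (intro power2_less_imp_less[OF _ less_imp_le[OF P]]) (simp only: power2_abs)
  then have pos: "P + 2 * (\<alpha> * \<beta>) > 0" "P - 2 * (\<alpha> * \<beta>) > 0" using P by linarith+
  define a b where "a = sqrt (P + 2 * (\<alpha> * \<beta>)) / 2" and "b = sqrt (P - 2 * (\<alpha> * \<beta>)) / 2"
  have ab: "a > 0" "b > 0" using pos by (simp_all add: a_def b_def)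
  have a2: "a\<^sup>2 = (P + 2 * (\<alpha> * \<beta>)) / 4" and b2: "b\<^sup>2 = (P - 2 * (\<alpha> * \<beta>)) / 4"
    using pos by (simp_all add: a_def b_def power_divide)
  have L: "L s \<noteq> 0" if s: "s \<in> J" for s
  proof
    assume L: "L s = 0"
    let ?f = "\<lambda>r. P * E r - (E r)\<^sup>2 - (\<alpha> * \<beta>)\<^sup>2"
    obtain e where e: "e > 0" "ball s e \<subseteq> J"
      using open_J s open_contains_ball by blast
    have "(?f has_real_derivative (P - 2 * E s) * E1 s) (at s)"
      by (auto intro!: derivative_eq_intros E_derivative s simp: algebra_simps)
    then have "(P - 2 * E s) * E1 s = 0"
    proof (rule DERIV_local_min[OF _ e(1)], intro allI impI)
      fix r assume "\<bar>s - r\<bar> < e"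
      then have "r \<in> J" using e(2) by (auto simp: dist_real_def)
      then show "?f s \<le> ?f r" using L2[OF s, symmetric] L2[of r, symmetric] L by simp
    qed
    moreover have "P - 2 * E s \<noteq> 0"
    proof
      assume "P - 2 * E s = 0"
      then show False using square[OF s] L disc by simp
    qed
    ultimately have "E1 s = 0" by simp
    then show False
      using stationary[OF s] slope_nonzero_at_zero_of_L[OF slope s L] by simp
  qed
  show ?thesis
  proof (rule that[OF ab _ slope L])
    show "a\<^sup>2 - b\<^sup>2 = \<alpha> * \<beta>" unfolding a2 b2 by (simp add: field_simps)
    have "4 * a\<^sup>2 = P + 2 * (\<alpha> * \<beta>)" "4 * b\<^sup>2 = P - 2 * (\<alpha> * \<beta>)" by (simp_all add: a2 b2)
    then show "(L s)\<^sup>2 + (E s - a\<^sup>2 - b\<^sup>2)\<^sup>2 = (2 * a * b)\<^sup>2" if "s \<in> J" for s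
      using L2[OF that] by algebra
  qed
qed

text \<open>The skew generator of the rotation group has Pfaffian $\alpha\beta$ up to sign. In the
  orthonormal frame formed by $X$, the unit vector along $X_t$, the unit vector orthogonal to it in the
  tangent plane, and the normal, only one product of entries survives in the Pfaffian, and it
  equals $(EM - FL)/W$ up to sign. With \<open>normal\<close> oriented as it is, the two signs agree.\<close>

lemma pfaffian_identity:
  assumes "s \<in> J"
  shows "E s * M s - F s * L s = \<alpha> * \<beta> * W s"
proof -
  define x y p q where "x = S s" and "y = C s" and "p = \<phi>1 s" and "q = \<theta>1 s"
  have xy: "x\<^sup>2 = 1 - y\<^sup>2"
    using sin_cos_squared_add[of "\<phi> s"] unfolding x_def y_def by linarith
  have unit: "y\<^sup>2 * q\<^sup>2 = 1 - p\<^sup>2"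
    using unit_speed[OF assms] by (simp add: y_def p_def q_def)
  have "(\<alpha>\<^sup>2 * y\<^sup>2 + \<beta>\<^sup>2 * x\<^sup>2) * (\<alpha> * \<beta> * (x\<^sup>2 + y\<^sup>2 * p\<^sup>2))
      - (\<alpha> * y\<^sup>2 * q) * (\<beta> * (\<alpha>\<^sup>2 - \<beta>\<^sup>2) * x\<^sup>2 * y\<^sup>2 * q)
      = \<alpha> * \<beta> * ((\<alpha>\<^sup>2 * y\<^sup>2 + \<beta>\<^sup>2 * x\<^sup>2) * (x\<^sup>2 + y\<^sup>2 * p\<^sup>2) - (\<alpha>\<^sup>2 - \<beta>\<^sup>2) * x\<^sup>2 * y\<^sup>2 * (y\<^sup>2 * q\<^sup>2))"
    by algebra
  also have "\<dots> = \<alpha> * \<beta> * (\<beta>\<^sup>2 * x\<^sup>2 + \<alpha>\<^sup>2 * y\<^sup>2 * p\<^sup>2)"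
    unfolding unit xy by algebra
  finally have "E s * M s - F s * L s = \<alpha> * \<beta> * \<Delta> s / W s"
    unfolding E_def F_def L_def M_def \<Delta>_def x_def y_def p_def q_def
    by (simp add: diff_divide_distrib[symmetric])
  then show ?thesis
    using W_nonzero[OF assms] unfolding W_square[OF assms, symmetric]
    by (simp add: power2_eq_square)
qed

end

section \<open>Asymptotic coordinates\<close>

lemma real_antiderivative:
  fixes f :: "real \<Rightarrow> real"
  assumes "continuous_on {a..b} f"
  obtains F where "\<And>x. x \<in> {a<..<b} \<Longrightarrow> (F has_real_derivative f x) (at x)"
proof
  fix x assume x: "x \<in> {a<..<b}"
  then have "((\<lambda>x. integral {a..x} f) has_real_derivative f x) (at x within {a..b})"
    by (intro integral_has_real_derivative assms) auto
  then show "((\<lambda>x. integral {a..x} f) has_real_derivative f x) (at x)"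
    using x by (simp only: at_within_Icc_at greaterThanLessThan_iff)
qed

text \<open>Two points with the same image have equal first coordinate once the second ones agree, and
  the combination $a g - b f$, which no longer involves the first coordinate, has no critical
  point. So the map is injective, and invariance of domain gives a continuous inverse.\<close>

lemma shear_diffeomorphism:
  fixes f g f' g' :: "real \<Rightarrow> real" and a b :: real
  defines "\<Phi> \<equiv> \<lambda>p :: real^2. (vector [a * p $ 1 + f (p $ 2), b * p $ 1 + g (p $ 2)] :: real^2)"
  assumes "open I" "is_interval I" "a \<noteq> 0"
    and f: "\<And>s. s \<in> I \<Longrightarrow> (f has_real_derivative f' s) (at s)" and f': "smooth_on I f'"
    and g: "\<And>s. s \<in> I \<Longrightarrow> (g has_real_derivative g' s) (at s)" and g': "smooth_on I g'"
    and nondegenerate: "\<And>s. s \<in> I \<Longrightarrow> a * g' s - b * f' s \<noteq> 0"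
  obtains U h where "open U" "diffeomorphism U {p. p $ 2 \<in> I} h \<Phi>"
    and "\<And>w s (\<xi> :: real^2). w \<in> U \<Longrightarrow> s = h w $ 2 \<Longrightarrow> frechet_derivative h (at w) \<xi> = vector
      [(g' s * \<xi> $ 1 - f' s * \<xi> $ 2) / (a * g' s - b * f' s),
       (a * \<xi> $ 2 - b * \<xi> $ 1) / (a * g' s - b * f' s)]"
proof -
  let ?V = "{p :: real^2. p $ 2 \<in> I}"
  let ?J = "\<lambda>s. a * g' s - b * f' s"
  let ?G = "\<lambda>(\<xi> :: real^2) (p :: real^2). vector [(g' (p $ 2) * \<xi> $ 1 - f' (p $ 2) * \<xi> $ 2) / ?J (p $ 2),
    (a * \<xi> $ 2 - b * \<xi> $ 1) / ?J (p $ 2)] :: real^2"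
  have V: "open ?V" by (rule open_strip[OF \<open>open I\<close>])
  have nth: "smooth_on ?V (\<lambda>p. p $ i)" for i :: 2
    by (rule smooth_on_bounded_linear[OF V bounded_linear_vec_nth])
  have strip: "smooth_on ?V (\<lambda>p. u (p $ 2))" if "smooth_on I u" for u :: "real \<Rightarrow> real"
    by (rule smooth_on_compose[OF V that nth]) auto
  have smooth_f: "smooth_on I f" and smooth_g: "smooth_on I g"
    using smooth_on_real_antiderivative[OF \<open>open I\<close>] f g f' g' by blast+
  have smooth_\<Phi>: "smooth_on ?V \<Phi>"
  proof (rule smooth_on_vec[OF V])
    show "smooth_on ?V (\<lambda>p. \<Phi> p $ i)" for i
      using exhaust_2[of i]
      by (elim disjE) (auto simp: \<Phi>_def vector_2
          intro!: smooth_on_add smooth_on_mult smooth_on_const V nth strip smooth_f smooth_g)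
  qed
  have d\<Phi>: "(\<Phi> has_derivative (\<lambda>v. vector [a * v $ 1 + f' (p $ 2) * v $ 2, b * v $ 1 + g' (p $ 2) * v $ 2])) (at p)"
    if p: "p \<in> ?V" for p
  proof -
    have nth1: "((\<lambda>q :: real^2. q $ 1) has_derivative (\<lambda>v. v $ 1)) (at p)"
      by (rule bounded_linear_imp_has_derivative[OF bounded_linear_vec_nth])
    have nth2: "((\<lambda>q :: real^2. u (q $ 2)) has_derivative (\<lambda>v. u' * v $ 2)) (at p)"
      if "(u has_real_derivative u') (at (p $ 2))" for u u'
      by (rule has_derivative_compose[OF bounded_linear_imp_has_derivative[OF bounded_linear_vec_nth]
            that[unfolded has_field_derivative_def]])
    have "((\<lambda>p. \<Phi> p $ i) has_derivative (\<lambda>v. (vector [a * v $ 1 + f' (p $ 2) * v $ 2, b * v $ 1 + g' (p $ 2) * v $ 2] :: real^2) $ i)) (at p)" for i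
      using exhaust_2[of i] p
      by (elim disjE) (auto simp: \<Phi>_def vector_2
          intro!: has_derivative_add has_derivative_mult_right nth1 nth2 f g)
    then show ?thesis
      by (subst has_derivative_componentwise_within) (auto simp: Basis_vec_def inner_axis)
  qed
  have inj: "inj_on \<Phi> ?V"
  proof (rule inj_onI)
    fix p q assume p: "p \<in> ?V" and q: "q \<in> ?V" and eq: "\<Phi> p = \<Phi> q"
    let ?y = "\<lambda>s. a * g s - b * f s"
    have y': "(?y has_real_derivative ?J s) (at s)" if "s \<in> I" for s
      by (intro DERIV_diff DERIV_cmult f g that)
    have no_repeat: "?y r \<noteq> ?y s" if "r < s" "r \<in> I" "s \<in> I" for r s
    proof
      assume eq: "?y r = ?y s"
      have sub: "x \<in> I" if "r \<le> x" "x \<le> s" for x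
        using mem_is_interval_1_I[OF \<open>is_interval I\<close> \<open>r \<in> I\<close> \<open>s \<in> I\<close> that] .
      have "continuous_on {r..s} ?y"
        by (intro continuous_at_imp_continuous_on ballI DERIV_isCont[OF y'] sub) auto
      moreover have "?y differentiable (at x)" if "r < x" "x < s" for x
        using y'[OF sub, of x] that real_differentiable_def by fastforce
      ultimately obtain x where "r < x" "x < s" "(?y has_real_derivative 0) (at x)"
        using Rolle[OF \<open>r < s\<close> eq] by blast
      then show False
        using DERIV_unique y'[OF sub, of x] nondegenerate[OF sub, of x] by fastforce
    qed
    have e1: "a * p $ 1 + f (p $ 2) = a * q $ 1 + f (q $ 2)"
      and e2: "b * p $ 1 + g (p $ 2) = b * q $ 1 + g (q $ 2)"
      using arg_cong[OF eq, of "\<lambda>v. v $ 1"] arg_cong[OF eq, of "\<lambda>v. v $ 2"]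
      by (simp_all add: \<Phi>_def vector_2)
    have "?y (p $ 2) = ?y (q $ 2)" using e1 e2 by algebra
    then have "\<not> p $ 2 < q $ 2" "\<not> q $ 2 < p $ 2"
      using no_repeat[of "p $ 2" "q $ 2"] no_repeat[of "q $ 2" "p $ 2"] p q by auto
    then have 2: "p $ 2 = q $ 2" by linarith
    then have "p $ 1 = q $ 1" using e1 \<open>a \<noteq> 0\<close> by simp
    with 2 show "p = q" by (simp add: vec_eq_iff forall_2)
  qed
  have cont: "continuous_on ?V \<Phi>" by (rule smooth_on_continuous_on[OF smooth_\<Phi>])
  define U where "U = \<Phi> ` ?V"
  have U: "open U" unfolding U_def by (rule invariance_of_domain[OF cont V inj])
  obtain h where "homeomorphism ?V U \<Phi> h"
    unfolding U_def using invariance_of_domain_homeomorphism[OF V cont _ inj] by auto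
  then have homeo: "homeomorphism U ?V h \<Phi>" by (rule homeomorphism_symD)
  have hV: "h w \<in> ?V" and \<Phi>h: "\<Phi> (h w) = w" if "w \<in> U" for w
    using homeo that unfolding homeomorphism_def by blast+
  have smooth_G: "smooth_on ?V (?G \<xi>)" for \<xi>
  proof (rule smooth_on_vec[OF V])
    show "smooth_on ?V (\<lambda>p. ?G \<xi> p $ i)" for i
      using exhaust_2[of i]
      by (elim disjE) (use nondegenerate in \<open>auto simp: vector_2
          intro!: smooth_on_divide smooth_on_diff smooth_on_mult smooth_on_const V
            strip[OF f'] strip[OF g']\<close>)
  qed
  have dh: "(h has_derivative (\<lambda>\<xi>. ?G \<xi> (h w))) (at w)" if w: "w \<in> U" for w
  proof (rule has_derivative_inverse_basic[OF d\<Phi>[OF hV[OF w]] _ _ _ U w \<Phi>h])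
    have J: "?J (h w $ 2) \<noteq> 0" using hV[OF w] nondegenerate by simp
    show "bounded_linear (\<lambda>\<xi>. ?G \<xi> (h w))"
      by (rule linear_conv_bounded_linear[THEN iffD1], rule linearI)
        (simp_all add: vec_eq_iff forall_2 vector_2 add_divide_distrib[symmetric] algebra_simps
          diff_divide_distrib[symmetric])
    show "(\<lambda>\<xi>. ?G \<xi> (h w)) \<circ> (\<lambda>v. vector [a * v $ 1 + f' (h w $ 2) * v $ 2, b * v $ 1 + g' (h w $ 2) * v $ 2]) = id"
      using J by (auto simp: fun_eq_iff vec_eq_iff forall_2 vector_2 field_simps)
    show "continuous (at w) h"
      using homeo U w by (auto simp: homeomorphism_def continuous_on_eq_continuous_at)
  qed
  have "smooth_on U h"
    by (rule smooth_on_bootstrap[OF U _ dh smooth_G]) (use hV in auto)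
  with homeo smooth_\<Phi> have diffeo: "diffeomorphism U ?V h \<Phi>"
    by (simp add: diffeomorphism_def)
  show ?thesis
    by (rule that[OF U diffeo]) (simp add: frechet_derivative_at[OF dh, symmetric])
qed

context flat_profile
begin

text \<open>The coordinate functions $u = a t + f(s)$ and $v = b t + g(s)$ are sought so that both are
  asymptotic and of unit speed. The coefficients $f'$ and $g'$ below make $II = 2 \sin\omega\,du\,dv$;
  the pfaffian identity then yields the coefficient \<open>F\<close>, and the coefficient of $ds^2$ follows by
  comparing determinants.\<close>

lemma asymptotic_form_coefficients:
  assumes s: "s \<in> J" and "a > 0" "b > 0" and ab: "a\<^sup>2 - b\<^sup>2 = \<alpha> * \<beta>" and L: "L s \<noteq> 0"
    and circle: "(L s)\<^sup>2 + (E s - a\<^sup>2 - b\<^sup>2)\<^sup>2 = (2 * a * b)\<^sup>2"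
  defines "f' \<equiv> a * (M s - W s) / L s" and "g' \<equiv> b * (M s + W s) / L s"
    and "x \<equiv> (E s - a\<^sup>2 - b\<^sup>2) / (2 * a * b)" and "y \<equiv> L s / (2 * a * b)"
  shows "E s = a\<^sup>2 + 2 * x * a * b + b\<^sup>2"
    and "F s = a * f' + x * (a * g' + b * f') + b * g'"
    and "1 = f'\<^sup>2 + 2 * x * f' * g' + g'\<^sup>2"
    and "L s = 2 * y * a * b" and "M s = y * (a * g' + b * f')" and "K s = 2 * y * f' * g'"
    and "x\<^sup>2 + y\<^sup>2 = 1" and "a * g' - b * f' = 2 * a * b * W s / L s"
proof -
  have a: "a \<noteq> 0" and b: "b \<noteq> 0" using \<open>a > 0\<close> \<open>b > 0\<close> by simp_all
  show E: "E s = a\<^sup>2 + 2 * x * a * b + b\<^sup>2" using a b by (simp add: x_def field_simps)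
  show y: "L s = 2 * y * a * b" using a b by (simp add: y_def)
  have "(2 * a * b * x)\<^sup>2 + (2 * a * b * y)\<^sup>2 = (2 * a * b)\<^sup>2"
    using circle a b by (simp add: x_def y_def)
  then have "(2 * a * b)\<^sup>2 * (x\<^sup>2 + y\<^sup>2) = (2 * a * b)\<^sup>2 * 1" by algebra
  then show xy: "x\<^sup>2 + y\<^sup>2 = 1" using a b by simp
  have sum: "a * g' + b * f' = 2 * a * b * M s / L s"
    unfolding f'_def g'_def using L by (simp add: field_simps)
  show diff: "a * g' - b * f' = 2 * a * b * W s / L s"
    unfolding f'_def g'_def using L by (simp add: field_simps)
  show "M s = y * (a * g' + b * f')" unfolding sum y_def using a b L by simp
  have "f' * g' = a * b * ((M s)\<^sup>2 - (W s)\<^sup>2) / (L s)\<^sup>2"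
    unfolding f'_def g'_def by (simp add: power2_eq_square algebra_simps)
  also have "\<dots> = a * b * K s / L s"
    unfolding W_square[OF s] gauss_equation[OF s, symmetric] using L by (simp add: power2_eq_square)
  finally have "2 * y * (f' * g') = K s" using L a b by (simp add: y_def)
  then show "K s = 2 * y * f' * g'" by (simp add: mult.assoc)
  have "a * f' + b * g' = ((a\<^sup>2 + b\<^sup>2) * M s - (a\<^sup>2 - b\<^sup>2) * W s) / L s"
    unfolding f'_def g'_def by (simp add: power2_eq_square diff_divide_distrib add_divide_distrib algebra_simps)
  moreover have "x * (a * g' + b * f') = (E s - a\<^sup>2 - b\<^sup>2) * M s / L s"
    unfolding sum x_def using a b by simp
  ultimately have "(a * f' + b * g') + x * (a * g' + b * f')
      = (((a\<^sup>2 + b\<^sup>2) * M s - \<alpha> * \<beta> * W s) + (E s - a\<^sup>2 - b\<^sup>2) * M s) / L s"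
    unfolding ab by (simp only: add_divide_distrib)
  then have "a * f' + x * (a * g' + b * f') + b * g' = (E s * M s - \<alpha> * \<beta> * W s) / L s"
    by (simp add: algebra_simps)
  also have "\<dots> = F s" using pfaffian_identity[OF s] L by (simp add: field_simps)
  finally show F: "F s = a * f' + x * (a * g' + b * f') + b * g'" by simp
  have "E s * (f'\<^sup>2 + 2 * x * f' * g' + g'\<^sup>2) - (F s)\<^sup>2 = (a * g' - b * f')\<^sup>2 * (1 - x\<^sup>2)"
    unfolding E F by algebra
  also have "\<dots> = ((a * g' - b * f') * y)\<^sup>2" using xy by algebra
  also have "\<dots> = (W s)\<^sup>2" unfolding diff y_def using L a b by simp
  also have "\<dots> = E s - (F s)\<^sup>2" unfolding W_square[OF s] E_F_\<Delta>[OF s] ..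
  finally show "1 = f'\<^sup>2 + 2 * x * f' * g' + g'\<^sup>2" using E_positive[OF s] by simp
qed

text \<open>The point $(x, y)$ moves on the unit circle, so it has an angle, and that angle is determined
  by its derivative. Here $\omega' = -2\kappa W/L$ is a constant-coefficient combination of $f'$
  and $g'$, with the coefficients for which \<open>t\<close> cancels from $\lambda_1 u + \lambda_2 v$.\<close>

lemma angle_affine:
  assumes I: "open I" "is_interval I" "I \<subseteq> J" "s\<^sub>0 \<in> I"
    and "a > 0" "b > 0"
    and slope: "\<And>s. s \<in> J \<Longrightarrow> E1 s = 2 * \<kappa> * W s" and L: "\<And>s. s \<in> J \<Longrightarrow> L s \<noteq> 0"
    and circle: "\<And>s. s \<in> J \<Longrightarrow> (L s)\<^sup>2 + (E s - a\<^sup>2 - b\<^sup>2)\<^sup>2 = (2 * a * b)\<^sup>2"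
    and f: "\<And>s. s \<in> I \<Longrightarrow> (f has_real_derivative a * (M s - W s) / L s) (at s)"
    and g: "\<And>s. s \<in> I \<Longrightarrow> (g has_real_derivative b * (M s + W s) / L s) (at s)"
  shows "\<exists>c. \<forall>s\<in>I. cos (\<kappa> / a * f s - \<kappa> / b * g s + c) = (E s - a\<^sup>2 - b\<^sup>2) / (2 * a * b)
    \<and> sin (\<kappa> / a * f s - \<kappa> / b * g s + c) = L s / (2 * a * b)"
proof -
  have a: "a \<noteq> 0" and b: "b \<noteq> 0" using \<open>a > 0\<close> \<open>b > 0\<close> by simp_all
  define x where "x s = (E s - a\<^sup>2 - b\<^sup>2) / (2 * a * b)" for s
  define y where "y s = L s / (2 * a * b)" for s
  define \<nu> where "\<nu> s = - 2 * \<kappa> * W s / L s" for s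
  have J: "s \<in> J" if "s \<in> I" for s using that I by blast
  have xy: "(x s)\<^sup>2 + (y s)\<^sup>2 = 1" if "s \<in> I" for s
  proof -
    have "(x s)\<^sup>2 + (y s)\<^sup>2 = ((L s)\<^sup>2 + (E s - a\<^sup>2 - b\<^sup>2)\<^sup>2) / (2 * a * b)\<^sup>2"
      by (simp add: x_def y_def power_divide add_divide_distrib)
    moreover have "(2 * a * b)\<^sup>2 \<noteq> 0" using a b by simp
    ultimately show ?thesis unfolding circle[OF J[OF that]] by simp
  qed
  have y0: "y s \<noteq> 0" if "s \<in> I" for s using L[OF J[OF that]] a b by (simp add: y_def)
  have x': "(x has_real_derivative - (\<nu> s * y s)) (at s)" if s: "s \<in> I" for s
  proof -
    have "(x has_real_derivative E1 s / (2 * a * b)) (at s)"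
      unfolding x_def[abs_def] by (auto intro!: derivative_eq_intros E_derivative J s simp: a b)
    moreover have "E1 s / (2 * a * b) = - (\<nu> s * y s)"
      using slope[OF J[OF s]] L[OF J[OF s]] by (simp add: \<nu>_def y_def)
    ultimately show ?thesis by simp
  qed
  have y': "(y has_real_derivative \<nu> s * x s) (at s)" if s: "s \<in> I" for s
  proof -
    obtain y1 where y1: "(y has_real_derivative y1) (at s)"
      using DERIV_cdivide[OF smooth_on_deriv(1)[OF open_J smooth_L J[OF s]]] unfolding y_def[abs_def] by blast
    have "((\<lambda>s. (x s)\<^sup>2 + (y s)\<^sup>2) has_real_derivative 2 * x s * - (\<nu> s * y s) + 2 * y s * y1) (at s)"
      by (auto intro!: derivative_eq_intros x' y1 s)
    moreover have "((\<lambda>s. (x s)\<^sup>2 + (y s)\<^sup>2) has_real_derivative 0) (at s)"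
      by (rule has_field_derivative_transform_within_open[OF DERIV_const[of 1] I(1) s])
        (simp add: xy)
    ultimately have "2 * x s * - (\<nu> s * y s) + 2 * y s * y1 = 0" by (rule DERIV_unique)
    then have "2 * y s * y1 = 2 * y s * (\<nu> s * x s)" by algebra
    then have "y1 = \<nu> s * x s" using y0[OF s] by simp
    with y1 show ?thesis by simp
  qed
  define \<Omega>\<^sub>0 where "\<Omega>\<^sub>0 s = \<kappa> / a * f s - \<kappa> / b * g s" for s
  obtain t where t: "x s\<^sub>0 = cos t" "y s\<^sub>0 = sin t"
    using sincos_total_2pi[OF xy[OF I(4)]] by metis
  define c where "c = t - \<Omega>\<^sub>0 s\<^sub>0"
  define \<Omega> where "\<Omega> s = \<Omega>\<^sub>0 s + c" for s
  have \<Omega>': "(\<Omega> has_real_derivative \<nu> s) (at s)" if s: "s \<in> I" for s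
    unfolding \<Omega>_def[abs_def] \<Omega>\<^sub>0_def[abs_def] \<nu>_def
    by (rule derivative_eq_intros refl f[OF s] g[OF s])+
      (use a b L[OF J[OF s]] in \<open>simp add: field_simps\<close>)
  \<comment> \<open>Both $(x, y)$ and $(\cos\Omega, \sin\Omega)$ turn with angular velocity \<open>\<nu>\<close>, so the cosine of
    the angle between them is constant.\<close>
  define r where "r s = x s * cos (\<Omega> s) + y s * sin (\<Omega> s)" for s
  have "(r has_real_derivative 0) (at s within I)" if s: "s \<in> I" for s
  proof -
    have "(r has_real_derivative 0) (at s)"
      unfolding r_def[abs_def]
      by (auto intro!: derivative_eq_intros x' y' \<Omega>' s simp: algebra_simps)
    then show ?thesis by (rule has_field_derivative_at_within)
  qed
  then obtain d where "\<And>s. s \<in> I \<Longrightarrow> r s = d"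
    using has_field_derivative_zero_constant[of I r] I(2) is_interval_convex by blast
  moreover have "r s\<^sub>0 = 1"
    using sin_cos_squared_add3[of t] by (simp add: r_def t \<Omega>_def c_def)
  ultimately have r: "r s = 1" if "s \<in> I" for s using that I(4) by metis
  have "cos (\<Omega> s) = x s \<and> sin (\<Omega> s) = y s" if s: "s \<in> I" for s
  proof -
    have "(x s - cos (\<Omega> s))\<^sup>2 + (y s - sin (\<Omega> s))\<^sup>2
        = ((x s)\<^sup>2 + (y s)\<^sup>2) + ((sin (\<Omega> s))\<^sup>2 + (cos (\<Omega> s))\<^sup>2) - 2 * r s"
      unfolding r_def by algebra
    also have "\<dots> = 0" unfolding xy[OF s] r[OF s] by simp
    finally show ?thesis by (simp add: sum_power2_eq_zero_iff)
  qed
  then show ?thesis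
    by (intro exI[of _ c]) (auto simp: \<Omega>_def \<Omega>\<^sub>0_def x_def y_def)
qed

lemma asymptotic_parametrization:
  assumes "p \<in> D"
  shows "\<exists>V U h k N. \<exists>l\<^sub>1 l\<^sub>2 l\<^sub>3 :: real. \<exists>\<omega> :: real^2 \<Rightarrow> real.
    open V \<and> p \<in> V \<and> V \<subseteq> D \<and> open U \<and> diffeomorphism U V h k \<and>
    unit_normal_field U (X \<circ> h) N \<and>
    (\<forall>w. \<omega> w = l\<^sub>1 * w $ 1 + l\<^sub>2 * w $ 2 + l\<^sub>3) \<and>
    (\<forall>w\<in>U. \<forall>\<xi>.
      first_fundamental_form (X \<circ> h) w \<xi> \<xi>
        = (\<xi> $ 1)\<^sup>2 + 2 * cos (\<omega> w) * \<xi> $ 1 * \<xi> $ 2 + (\<xi> $ 2)\<^sup>2 \<and>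
      second_fundamental_form (X \<circ> h) N w \<xi> \<xi>
        = 2 * sin (\<omega> w) * \<xi> $ 1 * \<xi> $ 2)"
proof -
  define s\<^sub>0 where "s\<^sub>0 = p $ 2"
  have s\<^sub>0: "s\<^sub>0 \<in> J" using assms by (simp add: s\<^sub>0_def)
  obtain \<kappa> a b where ab: "a > 0" "b > 0" "a\<^sup>2 - b\<^sup>2 = \<alpha> * \<beta>"
    and slope: "\<And>s. s \<in> J \<Longrightarrow> E1 s = 2 * \<kappa> * W s" and L: "\<And>s. s \<in> J \<Longrightarrow> L s \<noteq> 0"
    and circle: "\<And>s. s \<in> J \<Longrightarrow> (L s)\<^sup>2 + (E s - a\<^sup>2 - b\<^sup>2)\<^sup>2 = (2 * a * b)\<^sup>2"
    by (rule asymptotic_constants[OF s\<^sub>0]) (rule that)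
  define f' where "f' s = a * (M s - W s) / L s" for s
  define g' where "g' s = b * (M s + W s) / L s" for s
  have smooth_f': "smooth_on J f'" and smooth_g': "smooth_on J g'"
    unfolding f'_def[abs_def] g'_def[abs_def]
    by (intro smooth_on_intros open_J smooth_L smooth_M smooth_W L; assumption)+
  note forms = asymptotic_form_coefficients[OF _ ab L circle, folded f'_def g'_def]
  obtain e where e: "e > 0" "cball s\<^sub>0 e \<subseteq> J"
    using open_J s\<^sub>0 open_contains_cball by blast
  \<comment> \<open>An open interval whose closure lies in \<open>J\<close>, so that $f'$ and $g'$ can be integrated from its
    left end point.\<close>
  define I where "I = {s\<^sub>0 - e<..<s\<^sub>0 + e}"
  have I: "open I" "is_interval I" "I \<subseteq> J" "s\<^sub>0 \<in> I"
    using e by (auto simp: I_def is_interval_oo cball_eq_atLeastAtMost)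
  have "continuous_on {s\<^sub>0 - e..s\<^sub>0 + e} f'" "continuous_on {s\<^sub>0 - e..s\<^sub>0 + e} g'"
    using smooth_on_continuous_on[OF smooth_f'] smooth_on_continuous_on[OF smooth_g'] e(2)
    by (auto simp: cball_eq_atLeastAtMost intro: continuous_on_subset)
  then obtain f g where f: "\<And>s. s \<in> I \<Longrightarrow> (f has_real_derivative f' s) (at s)"
    and g: "\<And>s. s \<in> I \<Longrightarrow> (g has_real_derivative g' s) (at s)"
    unfolding I_def by (metis real_antiderivative)
  obtain c where cos: "\<And>s. s \<in> I \<Longrightarrow>
      cos (\<kappa> / a * f s - \<kappa> / b * g s + c) = (E s - a\<^sup>2 - b\<^sup>2) / (2 * a * b)"
    and sin: "\<And>s. s \<in> I \<Longrightarrow> sin (\<kappa> / a * f s - \<kappa> / b * g s + c) = L s / (2 * a * b)"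
    using angle_affine[OF I ab(1,2) slope L circle f[unfolded f'_def] g[unfolded g'_def]] by metis
  have nondegenerate: "a * g' s - b * f' s \<noteq> 0" if "s \<in> I" for s
  proof -
    have s: "s \<in> J" using that I by blast
    show ?thesis unfolding forms(8)[OF s s s] using ab L[OF s] W_nonzero[OF s] by simp
  qed
  let ?\<Phi> = "\<lambda>p :: real^2. vector [a * p $ 1 + f (p $ 2), b * p $ 1 + g (p $ 2)] :: real^2"
  let ?V = "{p :: real^2. p $ 2 \<in> I}"
  have "a \<noteq> 0" using ab by simp
  obtain U h where U: "open U" and diffeo: "diffeomorphism U ?V h ?\<Phi>"
    and dh: "\<And>w s (\<xi> :: real^2). w \<in> U \<Longrightarrow> s = h w $ 2 \<Longrightarrow> frechet_derivative h (at w) \<xi> = vector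
      [(g' s * \<xi> $ 1 - f' s * \<xi> $ 2) / (a * g' s - b * f' s),
       (a * \<xi> $ 2 - b * \<xi> $ 1) / (a * g' s - b * f' s)]"
    by (rule shear_diffeomorphism[OF I(1,2) \<open>a \<noteq> 0\<close> f smooth_on_subset[OF smooth_f' I(3)]
        g smooth_on_subset[OF smooth_g' I(3)] nondegenerate]) (assumption+, rule that)
  have hU: "h ` U \<subseteq> D" and smooth_h: "smooth_on U h"
    using diffeo I(3) unfolding diffeomorphism_def homeomorphism_def by auto
  note repar = fundamental_forms_reparametrize[OF open_D smooth_X unit_normal_field_normal U smooth_h hU]
  define \<omega> :: "real^2 \<Rightarrow> real" where "\<omega> w = \<kappa> / a * w $ 1 + - (\<kappa> / b) * w $ 2 + c" for w
  have fundamental_forms: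
    "first_fundamental_form (X \<circ> h) w \<xi> \<xi>
        = (\<xi> $ 1)\<^sup>2 + 2 * cos (\<omega> w) * \<xi> $ 1 * \<xi> $ 2 + (\<xi> $ 2)\<^sup>2"
    "second_fundamental_form (X \<circ> h) (normal \<circ> h) w \<xi> \<xi>
        = 2 * sin (\<omega> w) * \<xi> $ 1 * \<xi> $ 2" if w: "w \<in> U" for w \<xi>
  proof -
    define s where "s = h w $ 2"
    define \<zeta> where "\<zeta> = frechet_derivative h (at w) \<xi>"
    have hw: "h w \<in> ?V" "?\<Phi> (h w) = w"
      using diffeo w unfolding diffeomorphism_def homeomorphism_def by blast+
    have s: "s \<in> I" "s \<in> J" "h w \<in> D" using hw(1) I(3) by (auto simp: s_def)
    have "w $ 1 = a * h w $ 1 + f s" "w $ 2 = b * h w $ 1 + g s"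
      using arg_cong[OF hw(2), of "\<lambda>v. v $ 1"] arg_cong[OF hw(2), of "\<lambda>v. v $ 2"]
      by (simp_all add: vector_2 s_def)
    then have \<omega>: "\<omega> w = \<kappa> / a * f s - \<kappa> / b * g s + c"
      using ab by (simp add: \<omega>_def algebra_simps)
    note forms = forms[OF s(2) s(2) s(2), folded cos[OF s(1)] sin[OF s(1)], folded \<omega>]
    define j where "j = a * g' s - b * f' s"
    have j: "j \<noteq> 0" using nondegenerate[OF s(1)] by (simp add: j_def)
    have "\<zeta> $ 1 = (g' s * \<xi> $ 1 - f' s * \<xi> $ 2) / j" "\<zeta> $ 2 = (a * \<xi> $ 2 - b * \<xi> $ 1) / j"
      unfolding \<zeta>_def dh[OF w s_def] j_def by (simp_all add: vector_2)
    then have "j * \<zeta> $ 1 = g' s * \<xi> $ 1 - f' s * \<xi> $ 2" "j * \<zeta> $ 2 = a * \<xi> $ 2 - b * \<xi> $ 1"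
      using j by simp_all
    then have "j * \<xi> $ 1 = j * (a * \<zeta> $ 1 + f' s * \<zeta> $ 2)"
      "j * \<xi> $ 2 = j * (b * \<zeta> $ 1 + g' s * \<zeta> $ 2)"
      using j_def by algebra+
    then have \<xi>: "\<xi> $ 1 = a * \<zeta> $ 1 + f' s * \<zeta> $ 2" "\<xi> $ 2 = b * \<zeta> $ 1 + g' s * \<zeta> $ 2"
      using j by simp_all
    have "first_fundamental_form (X \<circ> h) w \<xi> \<xi>
        = E s * \<zeta> $ 1 * \<zeta> $ 1 + F s * (\<zeta> $ 1 * \<zeta> $ 2 + \<zeta> $ 2 * \<zeta> $ 1) + 1 * (\<zeta> $ 2 * \<zeta> $ 2)"
      by (simp add: repar(2)[OF w] first_fundamental_form_X[OF s(3) s_def] \<zeta>_def)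
    also have "\<dots> = (\<xi> $ 1)\<^sup>2 + 2 * cos (\<omega> w) * \<xi> $ 1 * \<xi> $ 2 + (\<xi> $ 2)\<^sup>2"
      unfolding \<xi> using forms(1-3) by algebra
    finally show "first_fundamental_form (X \<circ> h) w \<xi> \<xi>
        = (\<xi> $ 1)\<^sup>2 + 2 * cos (\<omega> w) * \<xi> $ 1 * \<xi> $ 2 + (\<xi> $ 2)\<^sup>2" .
    have "second_fundamental_form (X \<circ> h) (normal \<circ> h) w \<xi> \<xi>
        = L s * \<zeta> $ 1 * \<zeta> $ 1 + M s * (\<zeta> $ 1 * \<zeta> $ 2 + \<zeta> $ 2 * \<zeta> $ 1) + K s * \<zeta> $ 2 * \<zeta> $ 2"
      by (simp add: repar(3)[OF w] second_fundamental_form_normal[OF s(3) s_def] \<zeta>_def)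
    also have "\<dots> = 2 * sin (\<omega> w) * \<xi> $ 1 * \<xi> $ 2"
      unfolding \<xi> using forms(4-6) by algebra
    finally show "second_fundamental_form (X \<circ> h) (normal \<circ> h) w \<xi> \<xi>
        = 2 * sin (\<omega> w) * \<xi> $ 1 * \<xi> $ 2" .
  qed
  have "open ?V" "p \<in> ?V" "?V \<subseteq> D"
    using open_strip[OF I(1)] I(3,4) by (auto simp: s\<^sub>0_def)
  then have "open ?V \<and> p \<in> ?V \<and> ?V \<subseteq> D \<and> open U \<and> diffeomorphism U ?V h ?\<Phi> \<and>
    unit_normal_field U (X \<circ> h) (normal \<circ> h) \<and>
    (\<forall>w. \<omega> w = \<kappa> / a * w $ 1 + - (\<kappa> / b) * w $ 2 + c) \<and>
    (\<forall>w\<in>U. \<forall>\<xi>.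
      first_fundamental_form (X \<circ> h) w \<xi> \<xi>
        = (\<xi> $ 1)\<^sup>2 + 2 * cos (\<omega> w) * \<xi> $ 1 * \<xi> $ 2 + (\<xi> $ 2)\<^sup>2 \<and>
      second_fundamental_form (X \<circ> h) (normal \<circ> h) w \<xi> \<xi>
        = 2 * sin (\<omega> w) * \<xi> $ 1 * \<xi> $ 2)"
    using U diffeo repar(1) fundamental_forms by (intro conjI allI ballI \<omega>_def)
  then show ?thesis by (intro exI)
qed

end

theorem theorem2:
  fixes \<alpha> \<beta> :: real and \<phi> \<theta> :: "real \<Rightarrow> real" and J :: "real set"
    and X :: "real^2 \<Rightarrow> real^4" and D :: "(real^2) set"
  assumes "X = helicoidal_surface \<alpha> \<beta> (profile_curve \<phi> \<theta>)"
    and "D = {p. p $ 2 \<in> J}"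
    and "\<alpha> \<noteq> \<beta>" and "\<alpha> \<noteq> - \<beta>"
    and "open J" and "is_interval J"
    and "smooth_on J \<phi>" and "smooth_on J \<theta>"
    and "\<forall>s\<in>J. sin (\<phi> s) > 0"
    and "\<forall>s\<in>J. norm (vector_derivative (profile_curve \<phi> \<theta>) (at s)) = 1"
    and "immersion_on D X"
    and "flat_on D X"
  shows "\<forall>p\<in>D. \<exists>V W h k N. \<exists>l\<^sub>1 l\<^sub>2 l\<^sub>3 :: real. \<exists>\<omega> :: real^2 \<Rightarrow> real.
    open V \<and> p \<in> V \<and> V \<subseteq> D \<and> open W \<and> diffeomorphism W V h k \<and>
    unit_normal_field W (X \<circ> h) N \<and>
    (\<forall>w. \<omega> w = l\<^sub>1 * w $ 1 + l\<^sub>2 * w $ 2 + l\<^sub>3) \<and>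
    (\<forall>w\<in>W. \<forall>\<xi>.
      first_fundamental_form (X \<circ> h) w \<xi> \<xi>
        = (\<xi> $ 1)\<^sup>2 + 2 * cos (\<omega> w) * \<xi> $ 1 * \<xi> $ 2 + (\<xi> $ 2)\<^sup>2 \<and>
      second_fundamental_form (X \<circ> h) N w \<xi> \<xi>
        = 2 * sin (\<omega> w) * \<xi> $ 1 * \<xi> $ 2)"
proof -
  note deriv = smooth_on_deriv(1)[OF assms(5)]
  interpret unit_speed_profile \<alpha> \<beta> \<phi> \<theta> J
  proof
    show "(deriv \<phi> s)\<^sup>2 + (cos (\<phi> s))\<^sup>2 * (deriv \<theta> s)\<^sup>2 = 1" if "s \<in> J" for s
      using norm_vector_derivative_profile_curve[OF deriv[OF assms(7) that] deriv[OF assms(8) that]]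
        assms(10) that by simp
  qed (fact assms)+
  interpret regular_profile \<alpha> \<beta> \<phi> \<theta> J
    by standard (use \<Delta>_positive assms(1,2,11) in blast)
  interpret flat_profile \<alpha> \<beta> \<phi> \<theta> J
  proof
    show "\<alpha>\<^sup>2 \<noteq> \<beta>\<^sup>2" using assms(3,4) by (simp add: power2_eq_iff)
  qed (use assms in auto)
  show ?thesis
    unfolding assms(1,2) using asymptotic_parametrization by blast
qed

end
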